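(* Let $n\ge 3$ and let $M$ be an $n$-dimensional $C$-totally real submanifold of a $(2m+1)$-dimensional generalized $(\kappa,\mu)$-contact space form with divided $R_5$, $\tilde M(f_1,f_2,f_3,f_4,f_{5,1},f_{5,2},f_6)$. Then for every integer $k$ with $2\le k\le n$ and every point $p\in M$, $$\begin{aligned}n(n-1)\|H\|^{2}\ge{}& n(n-1)\theta_k(p)-n(n-1)f_{1}-2(n-1)f_{4}\operatorname{trace}(h^{T})\\&-f_{5,1}\{(\operatorname{trace}(h^{T}))^{2}-\|h^{T}\|^{2}\}+f_{5,2}\{\|(\phi h)^{T}\|^{2}-(\operatorname{trace}((\phi h)^{T}))^{2}\},\end{aligned}$$ where all quantities are evaluated at $p$.
   Context: An almost contact metric manifold $(\tilde M,\phi,\xi,\eta,\langle,\rangle)$ is a manifold with a $(1,1)$-tensor field $\phi$, a vector field $\xi$, a 1-form $\eta$ and a Riemannian metric $\langle,\rangle$ satisfying $\phi^2=-I+\eta\otimes\xi$, $\eta(\xi)=1$, $\eta\circ\phi=0$, $\phi\xi=0$, $\langle X,Y\rangle=\langle\phi X,\phi Y\rangle+\eta(X)\eta(Y)$, $\langle X,\xi\rangle=\eta(X)$, $\langle X,\phi Y\rangle=-\langle\phi X,Y\rangle$. It is a contact metric manifold if $d\eta(X,Y)=\langle X,\phi Y\rangle$. Put $2h=\mathcal L_\xi\phi$ (Lie derivative). On a contact metric manifold $h$ is symmetric, $h\xi=0$, $h\phi+\phi h=0$, $\operatorname{trace}h=\operatorname{trace}(\phi h)=0$, and $\tilde\nabla_X\xi=-\phi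 X-\phi hX$ (this fixes the normalization of $d\eta$). A generalized $(\kappa,\mu)$-space form with divided $R_5$, denoted $\tilde M(f_1,f_2,f_3,f_4,f_{5,1},f_{5,2},f_6)$, is an almost contact metric manifold with differentiable functions $f_1,f_2,f_3,f_4,f_{5,1},f_{5,2},f_6$ on $\tilde M$ such that its curvature tensor is $\tilde R=f_1R_1+f_2R_2+f_3R_3+f_4R_4+f_{5,1}R_{5,1}+f_{5,2}R_{5,2}+f_6R_6$, where $R_1(X,Y)Z=\langle Y,Z\rangle X-\langle X,Z\rangle Y$; $R_2(X,Y)Z=\langle X,\phi Z\rangle\phi Y-\langle Y,\phi Z\rangle\phi X+2\langle X,\phi Y\rangle\phi Z$; $R_3(X,Y)Z=\eta(X)\eta(Z)Y-\eta(Y)\eta(Z)X+\langle X,Z\rangle\eta(Y)\xi-\langle Y,Z\rangle\eta(X)\xi$; $R_4(X,Y)Z=\langle Y,Z\rangle hX-\langle X,Z\rangle hY+\langle hY,Z\rangle X-\langle hX,Z\rangle Y$; $R_{5,1}(X,Y)Z=\langle hY,Z\rangle hX-\langle hX,Z\rangle hY$; $R_{5,2}(X,Y)Z=\langle\phi hY,Z\rangle\phi hX-\langle\phi hX,Z\rangle\phi hY$; $R_6(X,Y)Z=\eta(X)\eta(Z)hY-\eta(Y)\eta(Z)hX+\langle hX,Z\rangle\eta(Y)\xi-\langle hY,Z\rangle\eta(X)\xi$. It is called a generalized $(\kappa,\mu)$-contact space form with divided $R_5$ when the structure is contact metric. Curvature convention: $\tilde R(X,Y,Z,W)=\langle\tilde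 R(X,Y)Z,W\rangle$, and the sectional curvature of the plane spanned by orthonormal $X,Y$ is $\tilde R(X,Y,Y,X)$ (similarly for $M$). A submanifold $M$ of a contact metric manifold $\tilde M$ is $C$-totally real if $\xi$ is normal to $M$ (every tangent vector lies in the contact distribution $\ker\eta$). $M$ carries the induced metric; $\sigma$ is its second fundamental form and $H=\frac1n\operatorname{trace}(\sigma)$ the mean curvature vector. For a $k$-plane section ($k$-dimensional subspace) $\Pi_k\subset T_pM$ and a unit vector $U\in\Pi_k$, choose an orthonormal basis $\{e_1=U,e_2,\dots,e_k\}$ of $\Pi_k$ and set $\operatorname{Ric}_{\Pi_k}(U)=\sum_{j=2}^kK(e_1\wedge e_j)$, where $K$ is the sectional curvature of $M$. For $2\le k\le n$, $\theta_k(p)=\frac1{k-1}\inf_{\Pi_k,X}\operatorname{Ric}_{\Pi_k}(X)$, the infimum over all $k$-plane sections $\Pi_k\subset T_pM$ and all unit vectors $X\in\Pi_k$. For $X$ tangent to $M$, $h^TX$ and $(\phi h)^TX$ are the components tangent to $M$ of $hX$ and $\phi hX$; for $Q\in\{h^T,(\phi h)^T\}$, $\|Q\|^2=\sum_{i,j=1}^n\langle e_i,Qe_j\rangle^2$ for an orthonormal basis $\{e_i\}$ of $T_pM$. *)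

theory Defs
  imports "HOL-Analysis.Analysis"
begin

section \<open>Smooth maps and smooth manifolds\<close>

abbreviation dirderiv ::
  "('a::real_normed_vector \<Rightarrow> 'b::real_normed_vector) \<Rightarrow> 'a \<Rightarrow> 'a \<Rightarrow> 'b"
  where "dirderiv f x v \<equiv> frechet_derivative f (at x) v"

primrec Ck_on :: "nat \<Rightarrow> 'a::euclidean_space set \<Rightarrow> ('a \<Rightarrow> 'b::real_normed_vector) \<Rightarrow> bool" where
  "Ck_on 0 S f \<longleftrightarrow> continuous_on S f"
| "Ck_on (Suc k) S f \<longleftrightarrow>
     (\<forall>x\<in>S. f differentiable (at x)) \<and> (\<forall>v. Ck_on k S (\<lambda>x. dirderiv f x v))"

definition smooth_on :: "'a::euclidean_space set \<Rightarrow> ('a \<Rightarrow> 'b::real_normed_vector) \<Rightarrow> bool"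
  where "smooth_on S f \<longleftrightarrow> (\<forall>k. Ck_on k S f)"

text \<open>A chart is its domain together with its coordinate map; the values of the coordinate map
  outside the domain are irrelevant.\<close>

type_synonym ('a, 'e) chart = "'a set \<times> ('a \<Rightarrow> 'e)"

abbreviation chart_dom :: "('a, 'e) chart \<Rightarrow> 'a set" where "chart_dom c \<equiv> fst c"

abbreviation coords :: "('a, 'e) chart \<Rightarrow> 'a \<Rightarrow> 'e" where "coords c \<equiv> snd c"

definition chart_image :: "('a, 'e) chart \<Rightarrow> 'e set"
  where "chart_image c = coords c ` chart_dom c"

definition chart_inv :: "('a, 'e) chart \<Rightarrow> 'e \<Rightarrow> 'a"
  where "chart_inv c = inv_into (chart_dom c) (coords c)"

definition overlap :: "('a, 'e) chart \<Rightarrow> ('a, 'e) chart \<Rightarrow> 'e set"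
  where "overlap c d = coords c ` (chart_dom c \<inter> chart_dom d)"

definition transition :: "('a, 'e) chart \<Rightarrow> ('a, 'e) chart \<Rightarrow> 'e \<Rightarrow> 'e"
  where "transition c d = coords d \<circ> chart_inv c"

text \<open>The atlas need not be maximal.  The dimension of the manifold is \<open>DIM('e)\<close>.\<close>

definition smooth_manifold :: "'a topology \<Rightarrow> ('a, 'e::euclidean_space) chart set \<Rightarrow> bool" where
  "smooth_manifold X A \<longleftrightarrow>
     Hausdorff_space X \<and> second_countable X \<and>
     (\<Union>c\<in>A. chart_dom c) = topspace X \<and>
     (\<forall>c\<in>A. openin X (chart_dom c) \<and> open (chart_image c) \<and>
        homeomorphic_map (subtopology X (chart_dom c)) (top_of_set (chart_image c)) (coords c)) \<and>
     (\<forall>c\<in>A. \<forall>d\<in>A. smooth_on (overlap c d) (transition c d))"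

section \<open>Tensor fields\<close>

text \<open>A tensor field is the family of its components in the charts of the atlas, subject to the
  usual transformation law.  Thus \<open>T c x\<close> is the tensor at the point with coordinates \<open>x\<close> in the
  chart \<open>c\<close>, acting on the coordinate representations of tangent vectors in \<open>c\<close>.\<close>

definition differentiable_function ::
  "('a, 'e::euclidean_space) chart set \<Rightarrow> ('a \<Rightarrow> real) \<Rightarrow> bool" where
  "differentiable_function A f \<longleftrightarrow> (\<forall>c\<in>A. (f \<circ> chart_inv c) differentiable_on chart_image c)"

definition vector_field ::
  "('a, 'e::euclidean_space) chart set \<Rightarrow> (('a, 'e) chart \<Rightarrow> 'e \<Rightarrow> 'e) \<Rightarrow> bool" where
  "vector_field A V \<longleftrightarrow>
     (\<forall>c\<in>A. smooth_on (chart_image c) (V c)) \<and>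
     (\<forall>c\<in>A. \<forall>d\<in>A. \<forall>x\<in>overlap c d.
        V d (transition c d x) = dirderiv (transition c d) x (V c x))"

definition one_form ::
  "('a, 'e::euclidean_space) chart set \<Rightarrow> (('a, 'e) chart \<Rightarrow> 'e \<Rightarrow> 'e \<Rightarrow> real) \<Rightarrow> bool" where
  "one_form A \<alpha> \<longleftrightarrow>
     (\<forall>c\<in>A. (\<forall>x\<in>chart_image c. linear (\<alpha> c x)) \<and>
        (\<forall>u. smooth_on (chart_image c) (\<lambda>x. \<alpha> c x u))) \<and>
     (\<forall>c\<in>A. \<forall>d\<in>A. \<forall>x\<in>overlap c d. \<forall>u.
        \<alpha> d (transition c d x) (dirderiv (transition c d) x u) = \<alpha> c x u)"

definition endomorphism_field ::
  "('a, 'e::euclidean_space) chart set \<Rightarrow> (('a, 'e) chart \<Rightarrow> 'e \<Rightarrow> 'e \<Rightarrow> 'e) \<Rightarrow> bool" where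
  "endomorphism_field A T \<longleftrightarrow>
     (\<forall>c\<in>A. (\<forall>x\<in>chart_image c. linear (T c x)) \<and>
        (\<forall>u. smooth_on (chart_image c) (\<lambda>x. T c x u))) \<and>
     (\<forall>c\<in>A. \<forall>d\<in>A. \<forall>x\<in>overlap c d. \<forall>u.
        T d (transition c d x) (dirderiv (transition c d) x u) =
          dirderiv (transition c d) x (T c x u))"

definition riemannian_metric ::
  "('a, 'e::euclidean_space) chart set \<Rightarrow> (('a, 'e) chart \<Rightarrow> 'e \<Rightarrow> 'e \<Rightarrow> 'e \<Rightarrow> real) \<Rightarrow> bool" where
  "riemannian_metric A g \<longleftrightarrow>
     (\<forall>c\<in>A.
        (\<forall>x\<in>chart_image c. bilinear (g c x) \<and> (\<forall>u v. g c x u v = g c x v u) \<and>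
           (\<forall>u. u \<noteq> 0 \<longrightarrow> 0 < g c x u u)) \<and>
        (\<forall>u v. smooth_on (chart_image c) (\<lambda>x. g c x u v))) \<and>
     (\<forall>c\<in>A. \<forall>d\<in>A. \<forall>x\<in>overlap c d. \<forall>u v.
        g d (transition c d x) (dirderiv (transition c d) x u) (dirderiv (transition c d) x v) =
          g c x u v)"

section \<open>Differential operators in a chart\<close>

text \<open>Below, fields are given by their components on an open subset of the model space \<open>'e\<close>.
  Tensorial expressions are evaluated on tangent vectors by extending the latter to fields that
  are constant in the chart.\<close>

definition lie_bracket :: "('e::euclidean_space \<Rightarrow> 'e) \<Rightarrow> ('e \<Rightarrow> 'e) \<Rightarrow> 'e \<Rightarrow> 'e" where
  "lie_bracket V W x = dirderiv W x (V x) - dirderiv V x (W x)"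

text \<open>The factor \<open>1/2\<close> is the normalization for which \<open>\<nabla>\<^sub>X \<xi> = - \<phi> X - \<phi> h X\<close> holds on contact
  metric manifolds.\<close>

definition ext_deriv :: "('e::euclidean_space \<Rightarrow> 'e \<Rightarrow> real) \<Rightarrow> 'e \<Rightarrow> 'e \<Rightarrow> 'e \<Rightarrow> real" where
  "ext_deriv \<alpha> x u v =
     (1/2) * (dirderiv (\<lambda>y. \<alpha> y v) x u - dirderiv (\<lambda>y. \<alpha> y u) x v
              - \<alpha> x (lie_bracket (\<lambda>_. u) (\<lambda>_. v) x))"

definition lie_deriv_endo ::
  "('e::euclidean_space \<Rightarrow> 'e) \<Rightarrow> ('e \<Rightarrow> 'e \<Rightarrow> 'e) \<Rightarrow> 'e \<Rightarrow> 'e \<Rightarrow> 'e" where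
  "lie_deriv_endo V T x u =
     lie_bracket V (\<lambda>y. T y u) x - T x (lie_bracket V (\<lambda>_. u) x)"

definition h_op :: "('e::euclidean_space \<Rightarrow> 'e) \<Rightarrow> ('e \<Rightarrow> 'e \<Rightarrow> 'e) \<Rightarrow> 'e \<Rightarrow> 'e \<Rightarrow> 'e" where
  "h_op \<xi> \<phi> x u = (1/2) *\<^sub>R lie_deriv_endo \<xi> \<phi> x u"

text \<open>\<open>christoffel g x u v\<close> is \<open>\<nabla>\<^sub>u v\<close> for constant fields \<open>u\<close>, \<open>v\<close>, where \<open>\<nabla>\<close> is the
  Levi-Civita connection of \<open>g\<close>, i.e. the unique torsion-free metric connection.\<close>

definition christoffel ::
  "('e::euclidean_space \<Rightarrow> 'e \<Rightarrow> 'e \<Rightarrow> real) \<Rightarrow> 'e \<Rightarrow> 'e \<Rightarrow> 'e \<Rightarrow> 'e" where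
  "christoffel g x =
     (THE \<Gamma>. bilinear \<Gamma> \<and> (\<forall>u v. \<Gamma> u v = \<Gamma> v u) \<and>
        (\<forall>u v w. dirderiv (\<lambda>y. g y v w) x u = g x (\<Gamma> u v) w + g x v (\<Gamma> u w)))"

definition cov_deriv ::
  "('e::euclidean_space \<Rightarrow> 'e \<Rightarrow> 'e \<Rightarrow> real) \<Rightarrow> ('e \<Rightarrow> 'e) \<Rightarrow> ('e \<Rightarrow> 'e) \<Rightarrow> 'e \<Rightarrow> 'e" where
  "cov_deriv g V W x = dirderiv W x (V x) + christoffel g x (V x) (W x)"

definition curvature_field ::
  "('e::euclidean_space \<Rightarrow> 'e \<Rightarrow> 'e \<Rightarrow> real) \<Rightarrow> ('e \<Rightarrow> 'e) \<Rightarrow> ('e \<Rightarrow> 'e) \<Rightarrow> ('e \<Rightarrow> 'e) \<Rightarrow> 'e \<Rightarrow> 'e"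
  where
  "curvature_field g U V W x =
     cov_deriv g U (cov_deriv g V W) x - cov_deriv g V (cov_deriv g U W) x
     - cov_deriv g (lie_bracket U V) W x"

text \<open>\<open>curvature g x u v w\<close> is \<open>R(u,v)w\<close>.\<close>

definition curvature ::
  "('e::euclidean_space \<Rightarrow> 'e \<Rightarrow> 'e \<Rightarrow> real) \<Rightarrow> 'e \<Rightarrow> 'e \<Rightarrow> 'e \<Rightarrow> 'e \<Rightarrow> 'e" where
  "curvature g x u v w = curvature_field g (\<lambda>_. u) (\<lambda>_. v) (\<lambda>_. w) x"

text \<open>Sectional curvature of the plane spanned by an orthonormal pair \<open>u\<close>, \<open>v\<close>.\<close>

definition sectional ::
  "('e::euclidean_space \<Rightarrow> 'e \<Rightarrow> 'e \<Rightarrow> real) \<Rightarrow> 'e \<Rightarrow> 'e \<Rightarrow> 'e \<Rightarrow> real" where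
  "sectional g x u v = g x (curvature g x u v v) u"

section \<open>Contact metric manifolds and generalized space forms with divided \<open>R\<^sub>5\<close>\<close>

definition almost_contact_metric ::
  "'a topology \<Rightarrow> ('a, 'e::euclidean_space) chart set \<Rightarrow>
   (('a, 'e) chart \<Rightarrow> 'e \<Rightarrow> 'e \<Rightarrow> 'e) \<Rightarrow> (('a, 'e) chart \<Rightarrow> 'e \<Rightarrow> 'e) \<Rightarrow>
   (('a, 'e) chart \<Rightarrow> 'e \<Rightarrow> 'e \<Rightarrow> real) \<Rightarrow> (('a, 'e) chart \<Rightarrow> 'e \<Rightarrow> 'e \<Rightarrow> 'e \<Rightarrow> real) \<Rightarrow> bool" where
  "almost_contact_metric X A \<phi> \<xi> \<eta> g \<longleftrightarrow>
     smooth_manifold X A \<and> endomorphism_field A \<phi> \<and> vector_field A \<xi> \<and> one_form A \<eta> \<and>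
     riemannian_metric A g \<and>
     (\<forall>c\<in>A. \<forall>x\<in>chart_image c.
        (\<forall>u. \<phi> c x (\<phi> c x u) = - u + \<eta> c x u *\<^sub>R \<xi> c x) \<and>
        \<eta> c x (\<xi> c x) = 1 \<and>
        (\<forall>u. \<eta> c x (\<phi> c x u) = 0) \<and>
        \<phi> c x (\<xi> c x) = 0 \<and>
        (\<forall>u v. g c x u v = g c x (\<phi> c x u) (\<phi> c x v) + \<eta> c x u * \<eta> c x v) \<and>
        (\<forall>u. g c x u (\<xi> c x) = \<eta> c x u) \<and>
        (\<forall>u v. g c x u (\<phi> c x v) = - g c x (\<phi> c x u) v))"

definition contact_metric ::
  "'a topology \<Rightarrow> ('a, 'e::euclidean_space) chart set \<Rightarrow>
   (('a, 'e) chart \<Rightarrow> 'e \<Rightarrow> 'e \<Rightarrow> 'e) \<Rightarrow> (('a, 'e) chart \<Rightarrow> 'e \<Rightarrow> 'e) \<Rightarrow>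
   (('a, 'e) chart \<Rightarrow> 'e \<Rightarrow> 'e \<Rightarrow> real) \<Rightarrow> (('a, 'e) chart \<Rightarrow> 'e \<Rightarrow> 'e \<Rightarrow> 'e \<Rightarrow> real) \<Rightarrow> bool" where
  "contact_metric X A \<phi> \<xi> \<eta> g \<longleftrightarrow>
     almost_contact_metric X A \<phi> \<xi> \<eta> g \<and>
     (\<forall>c\<in>A. \<forall>x\<in>chart_image c. \<forall>u v. ext_deriv (\<eta> c) x u v = g c x u (\<phi> c x v))"

text \<open>The tensors \<open>R\<^sub>1\<close>, ..., \<open>R\<^sub>6\<close> at a point, in terms of the values \<open>g\<close>, \<open>\<phi>\<close>, \<open>\<xi>\<close>, \<open>\<eta>\<close>, \<open>h\<close>
  of the structure tensors at that point.\<close>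

definition R1 :: "('e::euclidean_space \<Rightarrow> 'e \<Rightarrow> real) \<Rightarrow> 'e \<Rightarrow> 'e \<Rightarrow> 'e \<Rightarrow> 'e" where
  "R1 g X Y Z = g Y Z *\<^sub>R X - g X Z *\<^sub>R Y"

definition R2 :: "('e::euclidean_space \<Rightarrow> 'e \<Rightarrow> real) \<Rightarrow> ('e \<Rightarrow> 'e) \<Rightarrow> 'e \<Rightarrow> 'e \<Rightarrow> 'e \<Rightarrow> 'e" where
  "R2 g \<phi> X Y Z =
     g X (\<phi> Z) *\<^sub>R \<phi> Y - g Y (\<phi> Z) *\<^sub>R \<phi> X + (2 * g X (\<phi> Y)) *\<^sub>R \<phi> Z"

definition R3 ::
  "('e::euclidean_space \<Rightarrow> 'e \<Rightarrow> real) \<Rightarrow> 'e \<Rightarrow> ('e \<Rightarrow> real) \<Rightarrow> 'e \<Rightarrow> 'e \<Rightarrow> 'e \<Rightarrow> 'e" where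
  "R3 g \<xi> \<eta> X Y Z =
     (\<eta> X * \<eta> Z) *\<^sub>R Y - (\<eta> Y * \<eta> Z) *\<^sub>R X + (g X Z * \<eta> Y) *\<^sub>R \<xi> - (g Y Z * \<eta> X) *\<^sub>R \<xi>"

definition R4 :: "('e::euclidean_space \<Rightarrow> 'e \<Rightarrow> real) \<Rightarrow> ('e \<Rightarrow> 'e) \<Rightarrow> 'e \<Rightarrow> 'e \<Rightarrow> 'e \<Rightarrow> 'e" where
  "R4 g h X Y Z = g Y Z *\<^sub>R h X - g X Z *\<^sub>R h Y + g (h Y) Z *\<^sub>R X - g (h X) Z *\<^sub>R Y"

definition R51 :: "('e::euclidean_space \<Rightarrow> 'e \<Rightarrow> real) \<Rightarrow> ('e \<Rightarrow> 'e) \<Rightarrow> 'e \<Rightarrow> 'e \<Rightarrow> 'e \<Rightarrow> 'e" where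
  "R51 g h X Y Z = g (h Y) Z *\<^sub>R h X - g (h X) Z *\<^sub>R h Y"

definition R52 ::
  "('e::euclidean_space \<Rightarrow> 'e \<Rightarrow> real) \<Rightarrow> ('e \<Rightarrow> 'e) \<Rightarrow> ('e \<Rightarrow> 'e) \<Rightarrow> 'e \<Rightarrow> 'e \<Rightarrow> 'e \<Rightarrow> 'e" where
  "R52 g \<phi> h X Y Z = g (\<phi> (h Y)) Z *\<^sub>R \<phi> (h X) - g (\<phi> (h X)) Z *\<^sub>R \<phi> (h Y)"

definition R6 ::
  "('e::euclidean_space \<Rightarrow> 'e \<Rightarrow> real) \<Rightarrow> 'e \<Rightarrow> ('e \<Rightarrow> real) \<Rightarrow> ('e \<Rightarrow> 'e) \<Rightarrow> 'e \<Rightarrow> 'e \<Rightarrow> 'e \<Rightarrow> 'e" where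
  "R6 g \<xi> \<eta> h X Y Z =
     (\<eta> X * \<eta> Z) *\<^sub>R h Y - (\<eta> Y * \<eta> Z) *\<^sub>R h X + (g (h X) Z * \<eta> Y) *\<^sub>R \<xi> - (g (h Y) Z * \<eta> X) *\<^sub>R \<xi>"

definition gen_km_space_form_divided ::
  "'a topology \<Rightarrow> ('a, 'e::euclidean_space) chart set \<Rightarrow>
   (('a, 'e) chart \<Rightarrow> 'e \<Rightarrow> 'e \<Rightarrow> 'e) \<Rightarrow> (('a, 'e) chart \<Rightarrow> 'e \<Rightarrow> 'e) \<Rightarrow>
   (('a, 'e) chart \<Rightarrow> 'e \<Rightarrow> 'e \<Rightarrow> real) \<Rightarrow> (('a, 'e) chart \<Rightarrow> 'e \<Rightarrow> 'e \<Rightarrow> 'e \<Rightarrow> real) \<Rightarrow>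
   ('a \<Rightarrow> real) \<Rightarrow> ('a \<Rightarrow> real) \<Rightarrow> ('a \<Rightarrow> real) \<Rightarrow> ('a \<Rightarrow> real) \<Rightarrow> ('a \<Rightarrow> real) \<Rightarrow> ('a \<Rightarrow> real) \<Rightarrow>
   ('a \<Rightarrow> real) \<Rightarrow> bool" where
  "gen_km_space_form_divided X A \<phi> \<xi> \<eta> g f1 f2 f3 f4 f51 f52 f6 \<longleftrightarrow>
     almost_contact_metric X A \<phi> \<xi> \<eta> g \<and>
     (\<forall>f\<in>{f1, f2, f3, f4, f51, f52, f6}. differentiable_function A f) \<and>
     (\<forall>c\<in>A. \<forall>q\<in>chart_dom c.
        let x = coords c q; G = g c x; \<Phi> = \<phi> c x; \<Xi> = \<xi> c x; H = \<eta> c x;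
            h = h_op (\<xi> c) (\<phi> c) x
        in \<forall>u v w. curvature (g c) x u v w =
             f1 q *\<^sub>R R1 G u v w + f2 q *\<^sub>R R2 G \<Phi> u v w + f3 q *\<^sub>R R3 G \<Xi> H u v w
             + f4 q *\<^sub>R R4 G h u v w + f51 q *\<^sub>R R51 G h u v w + f52 q *\<^sub>R R52 G \<Phi> h u v w
             + f6 q *\<^sub>R R6 G \<Xi> H h u v w)"

definition gen_km_contact_space_form_divided ::
  "'a topology \<Rightarrow> ('a, 'e::euclidean_space) chart set \<Rightarrow>
   (('a, 'e) chart \<Rightarrow> 'e \<Rightarrow> 'e \<Rightarrow> 'e) \<Rightarrow> (('a, 'e) chart \<Rightarrow> 'e \<Rightarrow> 'e) \<Rightarrow>
   (('a, 'e) chart \<Rightarrow> 'e \<Rightarrow> 'e \<Rightarrow> real) \<Rightarrow> (('a, 'e) chart \<Rightarrow> 'e \<Rightarrow> 'e \<Rightarrow> 'e \<Rightarrow> real) \<Rightarrow>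
   ('a \<Rightarrow> real) \<Rightarrow> ('a \<Rightarrow> real) \<Rightarrow> ('a \<Rightarrow> real) \<Rightarrow> ('a \<Rightarrow> real) \<Rightarrow> ('a \<Rightarrow> real) \<Rightarrow> ('a \<Rightarrow> real) \<Rightarrow>
   ('a \<Rightarrow> real) \<Rightarrow> bool" where
  "gen_km_contact_space_form_divided X A \<phi> \<xi> \<eta> g f1 f2 f3 f4 f51 f52 f6 \<longleftrightarrow>
     contact_metric X A \<phi> \<xi> \<eta> g \<and>
     gen_km_space_form_divided X A \<phi> \<xi> \<eta> g f1 f2 f3 f4 f51 f52 f6"

section \<open>Submanifolds\<close>

text \<open>Submanifolds are immersed; the inclusion of an embedded submanifold is a special case.
  \<open>local_map c C f\<close> represents \<open>f\<close> in a chart \<open>c\<close> of the source and a chart \<open>C\<close> of the target.\<close>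

definition local_map ::
  "('b, 'v) chart \<Rightarrow> ('a, 'e) chart \<Rightarrow> ('b \<Rightarrow> 'a) \<Rightarrow> 'v \<Rightarrow> 'e" where
  "local_map c C f = coords C \<circ> f \<circ> chart_inv c"

definition local_dom :: "('b, 'v) chart \<Rightarrow> ('a, 'e) chart \<Rightarrow> ('b \<Rightarrow> 'a) \<Rightarrow> 'v set" where
  "local_dom c C f = coords c ` {q \<in> chart_dom c. f q \<in> chart_dom C}"

definition immersed_submanifold ::
  "'b topology \<Rightarrow> ('b, 'v::euclidean_space) chart set \<Rightarrow>
   'a topology \<Rightarrow> ('a, 'e::euclidean_space) chart set \<Rightarrow> ('b \<Rightarrow> 'a) \<Rightarrow> bool" where
  "immersed_submanifold Y B X A f \<longleftrightarrow>
     smooth_manifold Y B \<and> continuous_map Y X f \<and>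
     (\<forall>c\<in>B. \<forall>C\<in>A. smooth_on (local_dom c C f) (local_map c C f) \<and>
        (\<forall>y\<in>local_dom c C f. inj (dirderiv (local_map c C f) y)))"

definition C_totally_real ::
  "('b, 'v::euclidean_space) chart set \<Rightarrow> ('a, 'e::euclidean_space) chart set \<Rightarrow>
   (('a, 'e) chart \<Rightarrow> 'e \<Rightarrow> 'e) \<Rightarrow> (('a, 'e) chart \<Rightarrow> 'e \<Rightarrow> 'e \<Rightarrow> 'e \<Rightarrow> real) \<Rightarrow> ('b \<Rightarrow> 'a) \<Rightarrow> bool"
  where
  "C_totally_real B A \<xi> g f \<longleftrightarrow>
     (\<forall>c\<in>B. \<forall>C\<in>A. \<forall>y\<in>local_dom c C f. \<forall>u.
        let x = local_map c C f y
        in g C x (\<xi> C x) (dirderiv (local_map c C f) y u) = 0)"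

text \<open>In the remaining definitions \<open>F\<close> is the coordinate representation of the immersion and \<open>g\<close>
  that of the ambient metric.  A tangent vector of the submanifold at \<open>y\<close> is given by its
  components \<open>u :: 'v\<close>; as an ambient vector it is \<open>dirderiv F y u\<close>.\<close>

definition induced_metric ::
  "('e::euclidean_space \<Rightarrow> 'e \<Rightarrow> 'e \<Rightarrow> real) \<Rightarrow> ('v::euclidean_space \<Rightarrow> 'e) \<Rightarrow> 'v \<Rightarrow> 'v \<Rightarrow> 'v \<Rightarrow> real"
  where "induced_metric g F y u v = g (F y) (dirderiv F y u) (dirderiv F y v)"

text \<open>The tangential component of the ambient vector \<open>w\<close> at \<open>F y\<close>, as a tangent vector of the
  submanifold at \<open>y\<close>.\<close>

definition tangential ::
  "('e::euclidean_space \<Rightarrow> 'e \<Rightarrow> 'e \<Rightarrow> real) \<Rightarrow> ('v::euclidean_space \<Rightarrow> 'e) \<Rightarrow> 'v \<Rightarrow> 'e \<Rightarrow> 'v" where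
  "tangential g F y w = (THE u. \<forall>v. g (F y) (w - dirderiv F y u) (dirderiv F y v) = 0)"

definition tangential_part ::
  "('e::euclidean_space \<Rightarrow> 'e \<Rightarrow> 'e \<Rightarrow> real) \<Rightarrow> ('v::euclidean_space \<Rightarrow> 'e) \<Rightarrow> 'v \<Rightarrow> ('e \<Rightarrow> 'e) \<Rightarrow> 'v \<Rightarrow> 'v"
  where "tangential_part g F y T u = tangential g F y (T (dirderiv F y u))"

text \<open>The ambient covariant derivative, in direction \<open>u\<close>, of the field along \<open>F\<close> obtained from the
  constant field \<open>v\<close>; its normal component is the second fundamental form.\<close>

definition cov_deriv_along ::
  "('e::euclidean_space \<Rightarrow> 'e \<Rightarrow> 'e \<Rightarrow> real) \<Rightarrow> ('v::euclidean_space \<Rightarrow> 'e) \<Rightarrow> 'v \<Rightarrow> 'v \<Rightarrow> 'v \<Rightarrow> 'e" where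
  "cov_deriv_along g F y u v =
     dirderiv (\<lambda>z. dirderiv F z v) y u + christoffel g (F y) (dirderiv F y u) (dirderiv F y v)"

definition second_fundamental_form ::
  "('e::euclidean_space \<Rightarrow> 'e \<Rightarrow> 'e \<Rightarrow> real) \<Rightarrow> ('v::euclidean_space \<Rightarrow> 'e) \<Rightarrow> 'v \<Rightarrow> 'v \<Rightarrow> 'v \<Rightarrow> 'e" where
  "second_fundamental_form g F y u v =
     cov_deriv_along g F y u v - dirderiv F y (tangential g F y (cov_deriv_along g F y u v))"

section \<open>Orthonormal bases, traces and the invariants \<open>\<theta>\<^sub>k\<close>\<close>

text \<open>\<open>e 0\<close>, ..., \<open>e (k - 1)\<close> is an orthonormal basis of \<open>P\<close> for the inner product \<open>G\<close>.\<close>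

definition orthonormal_basis_of ::
  "('v::euclidean_space \<Rightarrow> 'v \<Rightarrow> real) \<Rightarrow> 'v set \<Rightarrow> nat \<Rightarrow> (nat \<Rightarrow> 'v) \<Rightarrow> bool" where
  "orthonormal_basis_of G P k e \<longleftrightarrow>
     (\<forall>i<k. \<forall>j<k. G (e i) (e j) = (if i = j then 1 else 0)) \<and> span (e ` {..<k}) = P"

text \<open>The following three quantities do not depend on the orthonormal basis \<open>e\<close> of the tangent
  space.\<close>

definition trace_wrt ::
  "('v::euclidean_space \<Rightarrow> 'v \<Rightarrow> real) \<Rightarrow> (nat \<Rightarrow> 'v) \<Rightarrow> ('v \<Rightarrow> 'v) \<Rightarrow> real" where
  "trace_wrt G e Q = (\<Sum>i<DIM('v). G (e i) (Q (e i)))"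

definition sqnorm_wrt ::
  "('v::euclidean_space \<Rightarrow> 'v \<Rightarrow> real) \<Rightarrow> (nat \<Rightarrow> 'v) \<Rightarrow> ('v \<Rightarrow> 'v) \<Rightarrow> real" where
  "sqnorm_wrt G e Q = (\<Sum>i<DIM('v). \<Sum>j<DIM('v). (G (e i) (Q (e j)))\<^sup>2)"

definition mean_curvature_vector ::
  "('e::euclidean_space \<Rightarrow> 'e \<Rightarrow> 'e \<Rightarrow> real) \<Rightarrow> ('v::euclidean_space \<Rightarrow> 'e) \<Rightarrow> 'v \<Rightarrow> (nat \<Rightarrow> 'v) \<Rightarrow> 'e"
  where
  "mean_curvature_vector g F y e =
     (1 / real DIM('v)) *\<^sub>R (\<Sum>i<DIM('v). second_fundamental_form g F y (e i) (e i))"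

text \<open>\<open>Ric_\<Pi>(e 0)\<close> for the plane section \<open>\<Pi>\<close> with orthonormal basis \<open>e 0\<close>, ..., \<open>e (k - 1)\<close>.\<close>

definition plane_ricci ::
  "('v::euclidean_space \<Rightarrow> 'v \<Rightarrow> 'v \<Rightarrow> real) \<Rightarrow> 'v \<Rightarrow> nat \<Rightarrow> (nat \<Rightarrow> 'v) \<Rightarrow> real" where
  "plane_ricci G y k e = (\<Sum>j=1..<k. sectional G y (e 0) (e j))"

definition theta_k :: "('v::euclidean_space \<Rightarrow> 'v \<Rightarrow> 'v \<Rightarrow> real) \<Rightarrow> 'v \<Rightarrow> nat \<Rightarrow> real" where
  "theta_k G y k =
     (1 / (real k - 1)) *
     Inf {plane_ricci G y k e | P U e.
            subspace P \<and> dim P = k \<and> U \<in> P \<and> G y U U = 1 \<and>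
            orthonormal_basis_of (G y) P k e \<and> e 0 = U}"

end

theory Submission
  imports Defs
begin

text \<open>At a point, the Gauss equation expresses the sectional curvatures of the submanifold through
  the ambient curvature and the second fundamental form \<open>\<sigma>\<close>.  The terms with \<open>f\<^sub>3\<close> and \<open>f\<^sub>6\<close>
  vanish because \<open>\<eta>\<close> is zero on tangent vectors, and the term with \<open>f\<^sub>2\<close> because \<open>d\<eta>\<close> is.  Hence
  twice the scalar curvature is the sum of the \<open>f\<^sub>1\<close>, \<open>f\<^sub>4\<close>, \<open>f\<^sub>5\<^sub>,\<^sub>1\<close>, \<open>f\<^sub>5\<^sub>,\<^sub>2\<close> terms of the statement and
  \<open>n\<^sup>2 \<parallel>H\<parallel>\<^sup>2 - \<parallel>\<sigma>\<parallel>\<^sup>2\<close>, where \<open>\<parallel>\<sigma>\<parallel>\<^sup>2 \<ge> n \<parallel>H\<parallel>\<^sup>2\<close>; averaging Ricci curvatures over the coordinate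
  \<open>k\<close>-planes of an orthonormal basis bounds it below by \<open>n (n - 1) \<theta>\<^sub>k\<close>.  The squared norms in the
  statement appear because \<open>h\<close> and \<open>\<phi>h\<close> are symmetric: the Lie derivatives of \<open>\<eta>\<close> and \<open>d\<eta>\<close> along
  \<open>\<xi>\<close> vanish, so \<open>\<langle>X, \<phi> (L\<^sub>\<xi> \<phi>) Y\<rangle>\<close> is the Lie derivative of a symmetric form.\<close>

section \<open>Calculus\<close>

lemma smooth_on_differentiable: "smooth_on S f \<Longrightarrow> x \<in> S \<Longrightarrow> f differentiable at x"
  unfolding smooth_on_def by (metis Ck_on.simps(2))

lemma smooth_on_dirderiv: "smooth_on S f \<Longrightarrow> smooth_on S (\<lambda>x. dirderiv f x v)"
  unfolding smooth_on_def by (metis Ck_on.simps(2))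

lemma smooth_on_continuous_on: "smooth_on S f \<Longrightarrow> continuous_on S f"
  unfolding smooth_on_def by (metis Ck_on.simps(1))

lemma has_derivative_dirderiv: "f differentiable at x \<Longrightarrow> (f has_derivative dirderiv f x) (at x)"
  by (simp add: frechet_derivative_works)

lemma dirderiv_eqI: "(f has_derivative D) (at x) \<Longrightarrow> dirderiv f x = D"
  by (metis frechet_derivative_at)

lemma linear_dirderiv: "f differentiable at x \<Longrightarrow> linear (dirderiv f x)"
  by (rule linear_frechet_derivative)

lemma dirderiv_cong_open:
  assumes "open S" "x \<in> S" "\<And>z. z \<in> S \<Longrightarrow> f z = g z" "f differentiable at x"
  shows "dirderiv f x = dirderiv g x"
  using frechet_derivative_transform_within_open[OF assms(4,1,2,3)] by simp

lemma differentiable_cong_open: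
  assumes "open S" "x \<in> S" "\<And>z. z \<in> S \<Longrightarrow> f z = g z" "f differentiable at x"
  shows "g differentiable at x"
  using assms has_derivative_transform_within_open unfolding differentiable_def by metis

lemma dirderiv_compose:
  assumes "f differentiable at (F y)" "F differentiable at y"
  shows "dirderiv (\<lambda>z. f (F z)) y v = dirderiv f (F y) (dirderiv F y v)"
    and "(\<lambda>z. f (F z)) differentiable at y"
proof -
  have "((\<lambda>z. f (F z)) has_derivative (\<lambda>v. dirderiv f (F y) (dirderiv F y v))) (at y)"
    using diff_chain_at[OF has_derivative_dirderiv[OF assms(2)] has_derivative_dirderiv[OF assms(1)]]
    by (simp add: o_def)
  then show "dirderiv (\<lambda>z. f (F z)) y v = dirderiv f (F y) (dirderiv F y v)"
    "(\<lambda>z. f (F z)) differentiable at y"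
    using dirderiv_eqI by (fastforce, auto simp: differentiable_def)
qed

section \<open>Symmetry of second derivatives\<close>

lemma dirderiv_line:
  assumes "f differentiable at (p + a *\<^sub>R u)"
  shows "((\<lambda>a. f (p + a *\<^sub>R u)) has_real_derivative dirderiv f (p + a *\<^sub>R u) u) (at a)"
proof -
  have "((\<lambda>a. p + a *\<^sub>R u) has_derivative (\<lambda>h. h *\<^sub>R u)) (at a)"
    by (auto intro!: derivative_eq_intros)
  from diff_chain_at[OF this has_derivative_dirderiv[OF assms]]
  have "((\<lambda>a. f (p + a *\<^sub>R u)) has_derivative (\<lambda>h. h * dirderiv f (p + a *\<^sub>R u) u)) (at a)"
    by (simp add: o_def linear_cmul[OF linear_dirderiv[OF assms]])
  then show ?thesis
    by (simp add: has_field_derivative_def mult_commute_abs)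
qed

text \<open>Two applications of the mean value theorem: first in the direction \<open>u\<close> to
  the increment of \<open>f\<close> by \<open>s *\<^sub>R v\<close>, then in the direction
  \<open>v\<close> to the resulting derivative. The left-hand side is symmetric in \<open>u\<close>
  and \<open>v\<close>, which is what the next lemma exploits.\<close>

lemma second_difference_mean_value:
  fixes f :: "'a::real_normed_vector \<Rightarrow> real"
  assumes "0 < s"
    and S: "\<And>a b. \<lbrakk>0 \<le> a; a \<le> s; 0 \<le> b; b \<le> s\<rbrakk> \<Longrightarrow> x + a *\<^sub>R u + b *\<^sub>R v \<in> S"
    and f: "\<And>z. z \<in> S \<Longrightarrow> f differentiable at z"
    and fu: "\<And>z. z \<in> S \<Longrightarrow> (\<lambda>y. dirderiv f y u) differentiable at z"
  obtains a b where "0 \<le> a" "a \<le> s" "0 \<le> b" "b \<le> s"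
    "f (x + s *\<^sub>R u + s *\<^sub>R v) - f (x + s *\<^sub>R u) - f (x + s *\<^sub>R v) + f x =
      s * s * dirderiv (\<lambda>y. dirderiv f y u) (x + a *\<^sub>R u + b *\<^sub>R v) v"
proof -
  define k where "k a = f (x + s *\<^sub>R v + a *\<^sub>R u) - f (x + a *\<^sub>R u)" for a
  have S0: "x + a *\<^sub>R u \<in> S" and S1: "x + s *\<^sub>R v + a *\<^sub>R u \<in> S" if "0 \<le> a" "a \<le> s" for a
    using S[OF that, of 0] S[OF that, of s] \<open>0 < s\<close> by (simp_all add: algebra_simps)
  have "(k has_real_derivative
      dirderiv f (x + s *\<^sub>R v + a *\<^sub>R u) u - dirderiv f (x + a *\<^sub>R u) u) (at a)"
    if "0 \<le> a" "a \<le> s" for a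
    unfolding k_def by (intro derivative_intros dirderiv_line f S0 S1 that)
  from MVT2[OF \<open>0 < s\<close> this] obtain a where a: "0 < a" "a < s"
    "k s - k 0 = s * (dirderiv f (x + s *\<^sub>R v + a *\<^sub>R u) u - dirderiv f (x + a *\<^sub>R u) u)" by auto
  have "((\<lambda>b. dirderiv f (x + a *\<^sub>R u + b *\<^sub>R v) u) has_real_derivative
      dirderiv (\<lambda>y. dirderiv f y u) (x + a *\<^sub>R u + b *\<^sub>R v) v) (at b)"
    if "0 \<le> b" "b \<le> s" for b
    by (rule dirderiv_line) (use fu S a that in auto)
  from MVT2[OF \<open>0 < s\<close> this] obtain b where b: "0 < b" "b < s"
    "dirderiv f (x + a *\<^sub>R u + s *\<^sub>R v) u - dirderiv f (x + a *\<^sub>R u) u =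
      s * dirderiv (\<lambda>y. dirderiv f y u) (x + a *\<^sub>R u + b *\<^sub>R v) v" by auto
  have "f (x + s *\<^sub>R u + s *\<^sub>R v) - f (x + s *\<^sub>R u) - f (x + s *\<^sub>R v) + f x = k s - k 0"
    by (simp add: k_def algebra_simps)
  also have "\<dots> = s * (s * dirderiv (\<lambda>y. dirderiv f y u) (x + a *\<^sub>R u + b *\<^sub>R v) v)"
    unfolding a(3) b(3)[symmetric] by (simp add: add.assoc add.commute[of "s *\<^sub>R v"])
  finally show ?thesis
    using that[of a b] a b by (simp add: mult.assoc)
qed

text \<open>The same second difference over a small parallelogram equals \<open>s * s\<close> times
  either mixed derivative, each at some point of the parallelogram. Since both mixed derivatives are
  continuous at \<open>x\<close>, a gap between their values there is contradictory.\<close>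

lemma mixed_derivatives_commute_real:
  fixes f :: "'a::real_normed_vector \<Rightarrow> real"
  assumes "open S" "x \<in> S"
    and f: "\<And>z. z \<in> S \<Longrightarrow> f differentiable at z"
    and fw: "\<And>z w. z \<in> S \<Longrightarrow> (\<lambda>y. dirderiv f y w) differentiable at z"
    and cont: "\<And>w w'. continuous_on S (\<lambda>z. dirderiv (\<lambda>y. dirderiv f y w) z w')"
  shows "dirderiv (\<lambda>y. dirderiv f y u) x v = dirderiv (\<lambda>y. dirderiv f y v) x u"
proof (rule ccontr)
  define P where "P z = dirderiv (\<lambda>y. dirderiv f y u) z v" for z
  define Q where "Q z = dirderiv (\<lambda>y. dirderiv f y v) z u" for z
  assume "\<not> ?thesis"
  then have ne: "\<bar>P x - Q x\<bar> > 0" by (simp add: P_def Q_def)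
  \<comment> \<open>Half of the gap: if \<open>P\<close> and \<open>Q\<close> agree at two points
    where each is strictly within \<open>\<epsilon>\<close> of its value at \<open>x\<close>, the
    gap is strictly smaller than itself.\<close>
  define \<epsilon> where "\<epsilon> = \<bar>P x - Q x\<bar> / 2"
  have \<epsilon>: "\<epsilon> > 0" using ne by (simp add: \<epsilon>_def)
  have "isCont P x" "isCont Q x"
    using cont[of u v] cont[of v u] assms(1,2)
    unfolding P_def Q_def by (simp_all add: continuous_on_eq_continuous_at)
  then obtain d1 d2 where d1: "d1 > 0" "\<And>z. dist z x < d1 \<Longrightarrow> dist (P z) (P x) < \<epsilon>"
    and d2: "d2 > 0" "\<And>z. dist z x < d2 \<Longrightarrow> dist (Q z) (Q x) < \<epsilon>"
    using \<epsilon> unfolding continuous_at_eps_delta by metis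
  obtain d3 where d3: "d3 > 0" "ball x d3 \<subseteq> S" by (rule openE[OF assms(1,2)])
  define d where "d = min d1 (min d2 d3)"
  \<comment> \<open>Keeps the parallelogram with sides \<open>s *\<^sub>R u\<close> and
    \<open>s *\<^sub>R v\<close> within distance \<open>d\<close> of \<open>x\<close>; the summand 1
    makes the denominator positive even for \<open>u = v = 0\<close>.\<close>
  define s where "s = d / (norm u + norm v + 1)"
  have nonneg: "0 \<le> norm u + norm v" by simp
  have "d > 0" using d1 d2 d3 by (simp add: d_def)
  then have s: "s > 0" by (simp add: s_def add_nonneg_pos)
  have near: "dist (x + a *\<^sub>R u + b *\<^sub>R v) x < d" if "0 \<le> a" "a \<le> s" "0 \<le> b" "b \<le> s" for a b
  proof -
    have "dist (x + a *\<^sub>R u + b *\<^sub>R v) x = norm (a *\<^sub>R u + b *\<^sub>R v)"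
      by (simp add: dist_norm algebra_simps)
    also have "\<dots> \<le> a * norm u + b * norm v"
      using norm_triangle_ineq[of "a *\<^sub>R u" "b *\<^sub>R v"] that by simp
    also have "\<dots> \<le> s * norm u + s * norm v"
      using that by (intro add_mono mult_right_mono) auto
    also have "\<dots> = s * (norm u + norm v)" by (rule distrib_left[symmetric])
    also have "\<dots> < s * (norm u + norm v + 1)"
      using nonneg by (intro mult_strict_left_mono[OF _ s]) linarith
    also have "\<dots> = d"
    proof -
      have "norm u + norm v + 1 \<noteq> 0" using nonneg by linarith
      then show ?thesis by (simp add: s_def)
    qed
    finally show ?thesis .
  qed
  have inS: "x + a *\<^sub>R u + b *\<^sub>R v \<in> S" if "0 \<le> a" "a \<le> s" "0 \<le> b" "b \<le> s" for a b
    using near[OF that] d3(2) by (auto simp: d_def dist_commute)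
  have inS': "x + a *\<^sub>R v + b *\<^sub>R u \<in> S" if "0 \<le> a" "a \<le> s" "0 \<le> b" "b \<le> s" for a b
    using inS[OF that(3,4,1,2)] by (simp add: algebra_simps)
  obtain a b where ab: "0 \<le> a" "a \<le> s" "0 \<le> b" "b \<le> s"
    "f (x + s *\<^sub>R u + s *\<^sub>R v) - f (x + s *\<^sub>R u) - f (x + s *\<^sub>R v) + f x =
      s * s * P (x + a *\<^sub>R u + b *\<^sub>R v)"
    unfolding P_def by (rule second_difference_mean_value[OF s inS f fw])
  obtain a' b' where ab': "0 \<le> a'" "a' \<le> s" "0 \<le> b'" "b' \<le> s"
    "f (x + s *\<^sub>R v + s *\<^sub>R u) - f (x + s *\<^sub>R v) - f (x + s *\<^sub>R u) + f x =
      s * s * Q (x + a' *\<^sub>R v + b' *\<^sub>R u)"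
    unfolding Q_def by (rule second_difference_mean_value[OF s inS' f fw])
  have swap: "x + s *\<^sub>R v + s *\<^sub>R u = x + s *\<^sub>R u + s *\<^sub>R v"
    "x + a' *\<^sub>R v + b' *\<^sub>R u = x + b' *\<^sub>R u + a' *\<^sub>R v"
    by (simp_all add: algebra_simps)
  have "s * s * P (x + a *\<^sub>R u + b *\<^sub>R v) = s * s * Q (x + b' *\<^sub>R u + a' *\<^sub>R v)"
    using ab(5) ab'(5) unfolding swap by linarith
  then have "P (x + a *\<^sub>R u + b *\<^sub>R v) = Q (x + b' *\<^sub>R u + a' *\<^sub>R v)" using s by simp
  moreover have "dist (P (x + a *\<^sub>R u + b *\<^sub>R v)) (P x) < \<epsilon>"
    by (rule d1(2)) (use near[OF ab(1-4)] in \<open>simp add: d_def\<close>)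
  moreover have "dist (Q (x + b' *\<^sub>R u + a' *\<^sub>R v)) (Q x) < \<epsilon>"
    by (rule d2(2)) (use near[OF ab'(3,4,1,2)] in \<open>simp add: d_def\<close>)
  ultimately have "\<bar>P x - Q x\<bar> < 2 * \<epsilon>" by (simp add: dist_real_def)
  then show False by (simp add: \<epsilon>_def)
qed

text \<open>Reduction to real-valued functions through the components
  \<open>f z \<bullet> b\<close>; the derivatives of a component are the components of the
  derivatives.\<close>

lemma mixed_derivatives_commute:
  fixes f :: "'a::euclidean_space \<Rightarrow> 'b::euclidean_space"
  assumes S: "open S" "x \<in> S" and f: "smooth_on S f"
  shows "dirderiv (\<lambda>y. dirderiv f y u) x v = dirderiv (\<lambda>y. dirderiv f y v) x u"
proof (rule euclidean_eqI)
  fix b :: 'b assume "b \<in> Basis"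
  define k where "k z = f z \<bullet> b" for z
  have inner: "((\<lambda>z. h z \<bullet> b) has_derivative (\<lambda>w. dirderiv h z w \<bullet> b)) (at z)"
    if "smooth_on S h" "z \<in> S" for z and h :: "'a \<Rightarrow> 'b"
    by (intro has_derivative_inner_left has_derivative_dirderiv smooth_on_differentiable[OF that])
  have k: "k differentiable at z" if "z \<in> S" for z
    using inner[OF f that] unfolding k_def differentiable_def by blast
  have dk: "dirderiv k z w = dirderiv f z w \<bullet> b" if "z \<in> S" for z w
    using dirderiv_eqI[OF inner[OF f that]] unfolding k_def by metis
  have kw: "((\<lambda>y. dirderiv k y w) has_derivative (\<lambda>w'. dirderiv (\<lambda>y. dirderiv f y w) z w' \<bullet> b)) (at z)"
    if "z \<in> S" for z w
    by (rule has_derivative_transform_within_open[OF inner[OF smooth_on_dirderiv[OF f] that] S(1) that])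
      (simp add: dk)
  have dkw: "dirderiv (\<lambda>y. dirderiv k y w) z w' = dirderiv (\<lambda>y. dirderiv f y w) z w' \<bullet> b"
    if "z \<in> S" for z w w'
    using dirderiv_eqI[OF kw[OF that]] by metis
  have "continuous_on S (\<lambda>z. dirderiv (\<lambda>y. dirderiv k y w) z w')" for w w'
  proof -
    have "continuous_on S (\<lambda>z. dirderiv (\<lambda>y. dirderiv f y w) z w' \<bullet> b)"
      by (intro continuous_intros smooth_on_continuous_on smooth_on_dirderiv f)
    then show ?thesis by (simp add: dkw cong: continuous_on_cong)
  qed
  moreover have "(\<lambda>y. dirderiv k y w) differentiable at z" if "z \<in> S" for z w
    using kw[OF that] unfolding differentiable_def by blast
  ultimately have "dirderiv (\<lambda>y. dirderiv k y u) x v = dirderiv (\<lambda>y. dirderiv k y v) x u"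
    by (intro mixed_derivatives_commute_real[OF S] k)
  then show "dirderiv (\<lambda>y. dirderiv f y u) x v \<bullet> b = dirderiv (\<lambda>y. dirderiv f y v) x u \<bullet> b"
    using dkw S(2) by simp
qed

section \<open>Product rules for families of linear and bilinear maps\<close>

text \<open>The domain of \<open>L z\<close> is finite-dimensional, so expanding the argument in the
  standard basis turns \<open>L z (w z)\<close> into a finite sum of products. Differentiability of
  \<open>L z u\<close> for each fixed \<open>u\<close> is therefore enough. This rule carries
  tensors given by their values on constant fields over to variable arguments.\<close>

lemma has_derivative_linear_family:
  fixes L :: "'p::real_normed_vector \<Rightarrow> 'a::euclidean_space \<Rightarrow> 'b::real_normed_vector"
  assumes S: "open S" "y \<in> S"
    and lin: "\<And>z. z \<in> S \<Longrightarrow> linear (L z)"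
    and L: "\<And>u. (\<lambda>z. L z u) differentiable at y"
    and w: "w differentiable at y"
  shows "((\<lambda>z. L z (w z)) has_derivative
    (\<lambda>v. dirderiv (\<lambda>z. L z (w y)) y v + L y (dirderiv w y v))) (at y)"
proof -
  have expand: "L z u = (\<Sum>b\<in>Basis. (u \<bullet> b) *\<^sub>R L z b)" if "z \<in> S" for z u
    using linear_sum[OF lin[OF that], of "\<lambda>b. (u \<bullet> b) *\<^sub>R b" Basis] linear_cmul[OF lin[OF that]]
    by (simp add: euclidean_representation)
  have Lb: "((\<lambda>z. L z b) has_derivative dirderiv (\<lambda>z. L z b) y) (at y)" for b
    by (intro has_derivative_dirderiv L)
  have *: "((\<lambda>z. \<Sum>b\<in>Basis. (u z \<bullet> b) *\<^sub>R L z b) has_derivative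
      (\<lambda>v. \<Sum>b\<in>Basis. (u y \<bullet> b) *\<^sub>R dirderiv (\<lambda>z. L z b) y v + (du v \<bullet> b) *\<^sub>R L y b)) (at y)"
    if "(u has_derivative du) (at y)" for u du
    by (intro has_derivative_sum has_derivative_scaleR has_derivative_inner_left Lb that)
  \<comment> \<open>The expansion with the argument frozen at \<open>w y\<close>; it identifies the
    first summand of the claimed derivative.\<close>
  have "((\<lambda>z. L z (w y)) has_derivative
      (\<lambda>v. \<Sum>b\<in>Basis. (w y \<bullet> b) *\<^sub>R dirderiv (\<lambda>z. L z b) y v + (0 \<bullet> b) *\<^sub>R L y b)) (at y)"
    by (rule has_derivative_transform_within_open[OF *[OF has_derivative_const] S])
      (rule expand[symmetric])
  note c = dirderiv_eqI[OF this]
  show ?thesis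
    unfolding c expand[OF S(2), of "dirderiv w y _"]
    by (rule has_derivative_eq_rhs, rule has_derivative_transform_within_open[OF
          *[OF has_derivative_dirderiv[OF w]] S])
      (simp_all add: expand[symmetric] sum.distrib)
qed

text \<open>The linear rule is used twice: for the second slot with the first one fixed, and then
  for the first slot of the family that already contains \<open>b z\<close>.\<close>

lemma has_derivative_bilinear_family:
  fixes B :: "'p::real_normed_vector \<Rightarrow> 'a::euclidean_space \<Rightarrow> 'c::euclidean_space \<Rightarrow> 'b::real_normed_vector"
  assumes S: "open S" "y \<in> S"
    and bil: "\<And>z. z \<in> S \<Longrightarrow> bilinear (B z)"
    and B: "\<And>u v. (\<lambda>z. B z u v) differentiable at y"
    and a: "a differentiable at y" and b: "b differentiable at y"
  shows "((\<lambda>z. B z (a z) (b z)) has_derivative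
    (\<lambda>v. dirderiv (\<lambda>z. B z (a y) (b y)) y v + B y (dirderiv a y v) (b y)
        + B y (a y) (dirderiv b y v))) (at y)"
proof -
  have 1: "((\<lambda>z. B z u (b z)) has_derivative
    (\<lambda>v. dirderiv (\<lambda>z. B z u (b y)) y v + B y u (dirderiv b y v))) (at y)" for u
    by (rule has_derivative_linear_family[OF S]) (use bil B b in \<open>auto simp: bilinear_def\<close>)
  have "((\<lambda>z. B z (a z) (b z)) has_derivative
    (\<lambda>v. dirderiv (\<lambda>z. B z (a y) (b z)) y v + B y (dirderiv a y v) (b y))) (at y)"
    by (rule has_derivative_linear_family[OF S, where L = "\<lambda>z u. B z u (b z)"])
      (use bil a in \<open>auto simp: bilinear_def intro: differentiableI[OF 1]\<close>)
  then show ?thesis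
    by (simp add: dirderiv_eqI[OF 1] add_ac)
qed

lemma linear_dirderiv_family:
  assumes "open S" "y \<in> S" and lin: "\<And>z. z \<in> S \<Longrightarrow> linear (L z)"
    and L: "\<And>u. (\<lambda>z. L z u) differentiable at y"
  shows "linear (\<lambda>u. dirderiv (\<lambda>z. L z u) y v)"
proof -
  note D = has_derivative_dirderiv[OF L]
  have add: "((\<lambda>z. L z (u + u')) has_derivative
      (\<lambda>v. dirderiv (\<lambda>z. L z u) y v + dirderiv (\<lambda>z. L z u') y v)) (at y)" for u u'
    by (rule has_derivative_transform_within_open[OF has_derivative_add[OF D D] assms(1,2)])
      (simp add: linear_add[OF lin])
  have scale: "((\<lambda>z. L z (r *\<^sub>R u)) has_derivative (\<lambda>v. r *\<^sub>R dirderiv (\<lambda>z. L z u) y v)) (at y)" for r u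
    by (rule has_derivative_transform_within_open[OF has_derivative_scaleR_right[OF D] assms(1,2)])
      (simp add: linear_cmul[OF lin])
  show ?thesis
    by (rule linearI) (simp_all add: dirderiv_eqI[OF add] dirderiv_eqI[OF scale])
qed

lemma bilinear_dirderiv_family:
  assumes "open S" "y \<in> S" and "\<And>z. z \<in> S \<Longrightarrow> bilinear (B z)"
    and "\<And>u w. (\<lambda>z. B z u w) differentiable at y"
  shows "bilinear (\<lambda>u w. dirderiv (\<lambda>z. B z u w) y v)"
  using assms unfolding bilinear_def
  by (auto intro!: linear_dirderiv_family[OF assms(1,2)])

section \<open>Differentiability of vectors represented by a varying inner product\<close>

text \<open>As \<open>\<rho>\<close> vanishes at \<open>x\<close> and is differentiable there,
  \<open>norm (\<rho> z)\<close> is at most a bounded multiple of \<open>norm (z - x)\<close> near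
  \<open>x\<close>; the factor \<open>M\<close> tending to 0 then makes \<open>e\<close> negligible
  to first order.\<close>

lemma has_derivative_zero_of_product_bound:
  fixes e :: "'a::real_normed_vector \<Rightarrow> 'b::real_normed_vector" and \<rho> :: "'a \<Rightarrow> 'c::real_normed_vector"
  assumes \<rho>: "(\<rho> has_derivative \<rho>') (at x)" "\<rho> x = 0" and e: "e x = 0"
    and M: "(M \<longlongrightarrow> 0) (at x)" "\<And>z. 0 \<le> M z"
    and bound: "\<forall>\<^sub>F z in at x. norm (e z) \<le> M z * norm (\<rho> z)"
  shows "(e has_derivative (\<lambda>_. 0)) (at x)"
proof -
  have bl: "bounded_linear \<rho>'" using \<rho>(1) by (rule has_derivative_bounded_linear)
  define q where "q z = norm (\<rho> z - \<rho>' (z - x)) / norm (z - x)" for z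
  have q: "(q \<longlongrightarrow> 0) (at x)"
    using \<rho> unfolding has_derivative_iff_norm q_def by simp
  have lim: "((\<lambda>z. M z * (q z + onorm \<rho>')) \<longlongrightarrow> 0 * (0 + onorm \<rho>')) (at x)"
    by (intro tendsto_intros M q)
  have "\<forall>\<^sub>F z in at x. norm (norm (e z) / norm (z - x)) \<le> M z * (q z + onorm \<rho>')"
    using bound eventually_neq_at_within[of x x UNIV]
  proof eventually_elim
    case (elim z)
    then have pos: "norm (z - x) > 0" by simp
    have "norm (\<rho> z) \<le> norm (\<rho> z - \<rho>' (z - x)) + norm (\<rho>' (z - x))"
      using norm_triangle_ineq[of "\<rho> z - \<rho>' (z - x)" "\<rho>' (z - x)"] by simp
    also have "\<dots> \<le> norm (\<rho> z - \<rho>' (z - x)) + onorm \<rho>' * norm (z - x)"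
      using onorm[OF bl] by simp
    also have "\<dots> = (q z + onorm \<rho>') * norm (z - x)"
      using pos by (simp add: q_def field_simps)
    finally have "norm (e z) \<le> M z * ((q z + onorm \<rho>') * norm (z - x))"
      using elim(1) mult_left_mono[OF _ M(2)] order_trans by blast
    then show ?case using pos by (simp add: field_simps)
  qed
  then have "((\<lambda>z. norm (e z) / norm (z - x)) \<longlongrightarrow> 0) (at x)"
    by (rule Lim_null_comparison) (use lim in simp)
  then show ?thesis
    unfolding has_derivative_iff_norm using e by simp
qed

section \<open>Inner products and Riemannian metrics in a coordinate domain\<close>

text \<open>The value of a Riemannian metric at a point. It is kept separate from the Euclidean
  inner product of the type, which only provides a basis, components and norms.\<close>

locale inner_form =
  fixes b :: "'a::euclidean_space \<Rightarrow> 'a \<Rightarrow> real"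
  assumes bil: "bilinear b"
    and sym: "b u v = b v u"
    and pos: "u \<noteq> 0 \<Longrightarrow> 0 < b u u"
begin

lemmas expand =
  bilinear_ladd[OF bil] bilinear_radd[OF bil] bilinear_lsub[OF bil] bilinear_rsub[OF bil]
  bilinear_lmul[OF bil] bilinear_rmul[OF bil] bilinear_lneg[OF bil] bilinear_rneg[OF bil]
  bilinear_lzero[OF bil] bilinear_rzero[OF bil]

lemma lin_left: "linear (\<lambda>u. b u v)" and lin_right: "linear (b u)"
  using bil by (auto simp: bilinear_def)

lemma sum_left: "b (\<Sum>i\<in>I. f i) v = (\<Sum>i\<in>I. b (f i) v)"
  by (rule linear_sum[OF lin_left])

lemma sum_right: "b v (\<Sum>i\<in>I. f i) = (\<Sum>i\<in>I. b v (f i))"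
  by (rule linear_sum[OF lin_right])

lemma nonneg: "0 \<le> b u u"
  using pos[of u] expand(9) by (cases "u = 0") auto

lemma eqI: "(\<And>w. b u w = b v w) \<Longrightarrow> u = v"
  using pos[of "u - v"] by (force simp: expand)

text \<open>The lowering of an index: the linear form \<open>b u\<close>, represented as a vector
  through the standard Euclidean inner product.\<close>

definition flat :: "'a \<Rightarrow> 'a" where "flat u = (\<Sum>i\<in>Basis. b u i *\<^sub>R i)"

lemma flat_inner: "i \<in> Basis \<Longrightarrow> flat u \<bullet> i = b u i"
  by (simp add: flat_def inner_sum_left_Basis)

lemma linear_flat: "linear flat"
  by (rule linearI) (auto intro!: euclidean_eqI[where 'a='a] simp: flat_inner expand inner_add_left)

lemma inj_flat: "inj flat"
proof (rule injI)
  fix u v assume "flat u = flat v"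
  then have "b u i = b v i" if "i \<in> Basis" for i using flat_inner[OF that] by metis
  then have "b u = b v" by (rule linear_eq_stdbasis[OF lin_right lin_right])
  then show "u = v" by (intro eqI) simp
qed

text \<open>Lowering an index is linear and injective on a finite-dimensional space, hence
  surjective.\<close>

lemma riesz:
  assumes "linear l"
  obtains u where "\<And>w. b u w = l w"
proof -
  have "surj flat" using linear_inj_imp_surj[OF linear_flat inj_flat] .
  then obtain u where "flat u = (\<Sum>i\<in>Basis. l i *\<^sub>R i)" by (metis surjD)
  then have "b u i = l i" if "i \<in> Basis" for i
    using flat_inner[OF that, of u] that by (simp add: inner_sum_left_Basis)
  then have "b u = l" by (rule linear_eq_stdbasis[OF lin_right assms])
  then show ?thesis by (intro that[of u]) simp
qed

lemma pullback:
  assumes "linear L" "inj L"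
  shows "inner_form (\<lambda>u v. b (L u) (L v))"
proof
  show "bilinear (\<lambda>u v. b (L u) (L v))"
    unfolding bilinear_def
    by (auto intro!: linearI simp: linear_add[OF assms(1)] linear_cmul[OF assms(1)] expand)
  show "0 < b (L u) (L u)" if "u \<noteq> 0" for u
    using pos[of "L u"] that linear_inj_iff_eq_0[OF assms(1)] assms(2) by blast
qed (rule sym)

end

text \<open>The linear system for \<open>w z\<close> is compared with the one at \<open>x\<close>,
  so no differentiability of matrix inversion is required. With \<open>r z = w z - w x\<close>, the
  vector \<open>x.flat (r z)\<close> is \<open>\<rho> z - e z\<close>, where \<open>\<rho>\<close>
  is visibly differentiable and \<open>e\<close> contains only products of increments of
  \<open>g\<close> with \<open>r z\<close>. Bounding \<open>r\<close> by \<open>\<rho>\<close> shows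
  that \<open>e\<close> has derivative zero.\<close>

lemma differentiable_riesz:
  fixes g :: "'p::real_normed_vector \<Rightarrow> 'a::euclidean_space \<Rightarrow> 'a \<Rightarrow> real"
  assumes S: "open S" "x \<in> S" and inner: "\<And>z. z \<in> S \<Longrightarrow> inner_form (g z)"
    and g: "\<And>u v. (\<lambda>z. g z u v) differentiable at x"
    and w: "\<And>z v. z \<in> S \<Longrightarrow> g z (w z) v = l z v"
    and l: "\<And>v. (\<lambda>z. l z v) differentiable at x"
  shows "w differentiable at x"
proof -
  interpret x: inner_form "g x" by (rule inner[OF S(2)])
  define r where "r z = w z - w x" for z
  define \<rho> where "\<rho> z = (\<Sum>i\<in>Basis. (l z i - g z (w x) i) *\<^sub>R i)" for z
  define e where "e z = (\<Sum>i\<in>Basis. (g z (r z) i - g x (r z) i) *\<^sub>R i)" for z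
  define N where "N z = (\<Sum>i\<in>Basis. \<Sum>j\<in>Basis. \<bar>g z j i - g x j i\<bar>)" for z
  have flat_r: "x.flat (r z) = \<rho> z - e z" if "z \<in> S" for z
  proof -
    interpret z: inner_form "g z" by (rule inner[OF that])
    have "\<rho> z - e z =
        (\<Sum>i\<in>Basis. (l z i - g z (w x) i - (g z (r z) i - g x (r z) i)) *\<^sub>R i)"
      unfolding \<rho>_def e_def by (simp only: scaleR_left_diff_distrib sum_subtractf)
    also have "\<dots> = x.flat (r z)"
      unfolding x.flat_def r_def by (simp add: z.expand w[OF that])
    finally show ?thesis by simp
  qed
  \<comment> \<open>An injective linear map in finite dimension is bounded below; this makes the
    system at \<open>x\<close> coercive.\<close>
  obtain \<kappa> where \<kappa>: "\<kappa> > 0" "\<And>u. \<kappa> * norm u \<le> norm (x.flat u)"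
    using linear_inj_bounded_below_pos[OF x.linear_flat x.inj_flat] by blast
  have N0: "0 \<le> N z" for z by (simp add: N_def sum_nonneg)
  have "isCont N x"
    unfolding N_def by (intro continuous_intros differentiable_imp_continuous_within g)
  then have N: "(N \<longlongrightarrow> 0) (at x)"
    by (simp add: isCont_def N_def[of x])
  have e: "norm (e z) \<le> N z * norm (r z)" if "z \<in> S" for z
  proof -
    interpret z: inner_form "g z" by (rule inner[OF that])
    have *: "g z u i - g x u i = (\<Sum>j\<in>Basis. (u \<bullet> j) * (g z j i - g x j i))" for u i
    proof -
      have "h u i = (\<Sum>j\<in>Basis. (u \<bullet> j) * h j i)" if "inner_form h" for h
      proof -
        interpret h: inner_form h by (rule that)
        have "h (\<Sum>j\<in>Basis. (u \<bullet> j) *\<^sub>R j) i = (\<Sum>j\<in>Basis. (u \<bullet> j) * h j i)"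
          by (simp add: h.sum_left h.expand)
        then show ?thesis by (simp add: euclidean_representation)
      qed
      from this[OF z.inner_form_axioms] this[OF x.inner_form_axioms]
      show ?thesis by (simp add: right_diff_distrib sum_subtractf)
    qed
    have "norm (e z) \<le> (\<Sum>i\<in>Basis. \<bar>g z (r z) i - g x (r z) i\<bar>)"
      unfolding e_def by (rule sum_norm_le) simp
    also have "\<dots> \<le> (\<Sum>i\<in>Basis. \<Sum>j\<in>Basis. norm (r z) * \<bar>g z j i - g x j i\<bar>)"
    proof (rule sum_mono)
      fix i :: 'a
      show "\<bar>g z (r z) i - g x (r z) i\<bar> \<le> (\<Sum>j\<in>Basis. norm (r z) * \<bar>g z j i - g x j i\<bar>)"
        unfolding *[of "r z" i] by (rule order_trans[OF sum_abs])
          (auto simp: abs_mult intro!: sum_mono mult_right_mono Basis_le_norm)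
    qed
    also have "\<dots> = N z * norm (r z)"
      by (simp add: N_def sum_distrib_left mult.commute)
    finally show ?thesis .
  qed
  have "\<forall>\<^sub>F z in at x. N z < \<kappa> / 2" using order_tendstoD(2)[OF N, of "\<kappa> / 2"] \<kappa>(1) by simp
  moreover have "\<forall>\<^sub>F z in at x. z \<in> S" using S by (simp add: eventually_at_in_open')
  \<comment> \<open>When \<open>N z\<close> is below \<open>\<kappa> / 2\<close>, the error
    \<open>e z\<close> costs at most half of the coercivity estimate, so \<open>r z\<close> is
    controlled by \<open>\<rho> z\<close>.\<close>
  ultimately have bound: "\<forall>\<^sub>F z in at x. norm (e z) \<le> (2 / \<kappa> * N z) * norm (\<rho> z)"
  proof eventually_elim
    case (elim z)
    have "\<kappa> * norm (r z) \<le> norm (\<rho> z) + norm (e z)"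
      using \<kappa>(2)[of "r z"] norm_triangle_ineq4[of "\<rho> z" "e z"] unfolding flat_r[OF elim(2)] by linarith
    moreover have "norm (e z) \<le> \<kappa> / 2 * norm (r z)"
      by (rule order_trans[OF e[OF elim(2)]], rule mult_right_mono) (use elim(1) in auto)
    ultimately have "norm (r z) \<le> 2 / \<kappa> * norm (\<rho> z)" using \<kappa>(1) by (simp add: field_simps)
    then have "N z * norm (r z) \<le> N z * (2 / \<kappa> * norm (\<rho> z))" by (rule mult_left_mono[OF _ N0])
    with e[OF elim(2)] show ?case by (simp add: mult_ac)
  qed
  have \<rho>: "\<rho> differentiable at x"
    unfolding \<rho>_def
    by (intro differentiable_sum ballI differentiable_scaleR differentiable_diff g l
        differentiable_const finite_Basis)
  have r0: "r x = 0" by (simp add: r_def)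
  have e0: "e x = 0" by (simp add: e_def)
  have \<rho>0: "\<rho> x = 0" using flat_r[OF S(2)] by (simp add: r0 e0 linear_0[OF x.linear_flat])
  have "(e has_derivative (\<lambda>_. 0)) (at x)"
  proof (rule has_derivative_zero_of_product_bound[OF has_derivative_dirderiv[OF \<rho>] \<rho>0 e0 _ _ bound])
    show "((\<lambda>z. 2 / \<kappa> * N z) \<longlongrightarrow> 0) (at x)" using tendsto_mult_left[OF N, of "2 / \<kappa>"] by simp
    show "0 \<le> 2 / \<kappa> * N z" for z using N0 \<kappa>(1) by simp
  qed
  then have de: "e differentiable at x" by (rule differentiableI)
  \<comment> \<open>The left inverse of \<open>x.flat\<close> recovers \<open>w z\<close> from
    \<open>\<rho> z - e z\<close>, whose differentiability is now known.\<close>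
  obtain f where f: "linear f" "f \<circ> x.flat = id"
    using linear_injective_left_inverse[OF x.linear_flat x.inj_flat] by blast
  have "(\<lambda>z. w x + f (\<rho> z - e z)) differentiable at x"
    by (intro differentiable_add differentiable_const differentiable_diff \<rho> de
        differentiable_compose[OF linear_imp_differentiable[OF f(1)]])
  moreover have "w x + f (\<rho> z - e z) = w z" if "z \<in> S" for z
    using fun_cong[OF f(2), of "r z"] unfolding flat_r[OF that, symmetric] by (simp add: r_def)
  ultimately show ?thesis by (rule differentiable_cong_open[OF S, rotated])
qed

section \<open>The Levi-Civita connection in coordinates\<close>

text \<open>Only the derivatives that enter the curvature are asked for. The induced metric can thus
  be made an instance without first being shown to be smooth.\<close>

locale coordinate_metric =
  fixes g :: "'e::euclidean_space \<Rightarrow> 'e \<Rightarrow> 'e \<Rightarrow> real" and S :: "'e set"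
  assumes open_S: "open S"
    and inner: "x \<in> S \<Longrightarrow> inner_form (g x)"
    and diff_g: "x \<in> S \<Longrightarrow> (\<lambda>z. g z u v) differentiable at x"
    and diff_dg: "x \<in> S \<Longrightarrow> (\<lambda>z. dirderiv (\<lambda>y. g y u v) z w) differentiable at x"
begin

lemma sym: "x \<in> S \<Longrightarrow> g x u v = g x v u"
  using inner_form.sym[OF inner] .

lemma bil: "x \<in> S \<Longrightarrow> bilinear (g x)"
  using inner_form.bil[OF inner] .

lemma dg_sym: "x \<in> S \<Longrightarrow> dirderiv (\<lambda>y. g y u v) x w = dirderiv (\<lambda>y. g y v u) x w"
  using dirderiv_cong_open[OF open_S _ sym diff_g] by metis

lemma bilinear_dg: "x \<in> S \<Longrightarrow> bilinear (\<lambda>u v. dirderiv (\<lambda>y. g y u v) x w)"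
  by (rule bilinear_dirderiv_family[OF open_S _ bil diff_g])

lemmas dg_expand =
  bilinear_ladd[OF bilinear_dg] bilinear_radd[OF bilinear_dg]
  bilinear_lmul[OF bilinear_dg] bilinear_rmul[OF bilinear_dg]
  linear_add[OF linear_dirderiv[OF diff_g]] linear_cmul[OF linear_dirderiv[OF diff_g]]

text \<open>Koszul's formula without its bracket terms, which vanish for constant fields.\<close>

definition koszul :: "'e \<Rightarrow> 'e \<Rightarrow> 'e \<Rightarrow> 'e \<Rightarrow> real" where
  "koszul x u v w = (dirderiv (\<lambda>y. g y v w) x u + dirderiv (\<lambda>y. g y u w) x v
    - dirderiv (\<lambda>y. g y u v) x w) / 2"

text \<open>The condition of the definite description in \<open>christoffel\<close>; existence and
  uniqueness below show that the description denotes.\<close>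

definition levi_civita :: "'e \<Rightarrow> ('e \<Rightarrow> 'e \<Rightarrow> 'e) \<Rightarrow> bool" where
  "levi_civita x \<Gamma> \<longleftrightarrow> bilinear \<Gamma> \<and> (\<forall>u v. \<Gamma> u v = \<Gamma> v u) \<and>
     (\<forall>u v w. dirderiv (\<lambda>y. g y v w) x u = g x (\<Gamma> u v) w + g x v (\<Gamma> u w))"

text \<open>Expanding the three derivatives by metric compatibility, the symmetry of
  \<open>\<Gamma>\<close> cancels everything except two copies of
  \<open>g x (\<Gamma> u v) w\<close>.\<close>

lemma levi_civita_koszul:
  assumes x: "x \<in> S" and "levi_civita x \<Gamma>"
  shows "g x (\<Gamma> u v) w = koszul x u v w"
proof -
  have \<Gamma>: "\<Gamma> u v = \<Gamma> v u" "dirderiv (\<lambda>y. g y v w) x u = g x (\<Gamma> u v) w + g x v (\<Gamma> u w)" for u v w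
    using assms(2) unfolding levi_civita_def by blast+
  show ?thesis
    unfolding koszul_def \<Gamma>(2)
    using \<Gamma>(1)[of u w] \<Gamma>(1)[of v w] \<Gamma>(1)[of u v] sym[OF x] by simp
qed

lemma levi_civita_unique:
  assumes x: "x \<in> S" and "levi_civita x \<Gamma>" "levi_civita x \<Gamma>'"
  shows "\<Gamma> = \<Gamma>'"
  using levi_civita_koszul[OF x assms(2)] levi_civita_koszul[OF x assms(3)]
  by (intro ext inner_form.eqI[OF inner[OF x]]) simp

text \<open>The vector representing \<open>koszul x u v\<close> is taken as
  \<open>\<Gamma> u v\<close>. Nondegeneracy of \<open>g x\<close> transfers linearity and symmetry
  from the Koszul expression to \<open>\<Gamma>\<close>.\<close>

lemma levi_civita_exists:
  assumes x: "x \<in> S"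
  shows "\<exists>\<Gamma>. levi_civita x \<Gamma>"
proof -
  interpret x: inner_form "g x" by (rule inner[OF x])
  have "\<exists>a. \<forall>w. g x a w = koszul x u v w" for u v
  proof -
    have "linear (koszul x u v)"
      by (rule linearI) (simp_all add: koszul_def dg_expand x field_simps)
    from x.riesz[OF this] show ?thesis by blast
  qed
  then obtain \<Gamma> where \<Gamma>: "\<And>u v w. g x (\<Gamma> u v) w = koszul x u v w" by metis
  have \<Gamma>_sym: "\<Gamma> u v = \<Gamma> v u" for u v
    by (rule x.eqI) (simp add: \<Gamma> koszul_def dg_sym[OF x, of u v])
  have lin: "linear (\<lambda>u. \<Gamma> u v)" for v
  proof (rule linearI)
    show "\<Gamma> (u + u') v = \<Gamma> u v + \<Gamma> u' v" for u u'
      by (rule x.eqI) (simp add: x.expand(1) \<Gamma> koszul_def dg_expand x add_divide_distrib diff_divide_distrib)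
    show "\<Gamma> (r *\<^sub>R u) v = r *\<^sub>R \<Gamma> u v" for r u
      by (rule x.eqI) (simp add: x.expand(5) \<Gamma> koszul_def dg_expand x algebra_simps)
  qed
  then have "bilinear \<Gamma>"
    using lin \<Gamma>_sym by (simp add: bilinear_def)
  moreover have "dirderiv (\<lambda>y. g y v w) x u = g x (\<Gamma> u v) w + g x v (\<Gamma> u w)" for u v w
    unfolding x.sym[of v "\<Gamma> u w"] \<Gamma> koszul_def
    by (simp add: dg_sym[OF x, of w u] dg_sym[OF x, of w v] dg_sym[OF x, of v u] field_simps)
  ultimately show ?thesis unfolding levi_civita_def using \<Gamma>_sym by blast
qed

lemma levi_civita_christoffel:
  assumes x: "x \<in> S"
  shows "levi_civita x (christoffel g x)"
proof -
  obtain \<Gamma> where \<Gamma>: "levi_civita x \<Gamma>" using levi_civita_exists[OF x] by blast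
  have "christoffel g x = (THE \<Gamma>. levi_civita x \<Gamma>)"
    by (simp add: christoffel_def levi_civita_def)
  also have "\<dots> = \<Gamma>" by (rule the_equality) (use \<Gamma> levi_civita_unique[OF x] in blast)+
  finally show ?thesis using \<Gamma> by simp
qed

lemma christoffel_eqI: "x \<in> S \<Longrightarrow> levi_civita x \<Gamma> \<Longrightarrow> christoffel g x = \<Gamma>"
  using levi_civita_unique[OF _ levi_civita_christoffel] by blast

lemma bilinear_christoffel: "x \<in> S \<Longrightarrow> bilinear (christoffel g x)"
  and christoffel_sym: "x \<in> S \<Longrightarrow> christoffel g x u v = christoffel g x v u"
  and christoffel_compat: "x \<in> S \<Longrightarrow>
    dirderiv (\<lambda>y. g y v w) x u = g x (christoffel g x u v) w + g x v (christoffel g x u w)"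
  using levi_civita_christoffel unfolding levi_civita_def by blast+

text \<open>The Christoffel symbol is the vector representing the Koszul expression, which is
  differentiable because the first derivatives of \<open>g\<close> are.\<close>

lemma differentiable_christoffel:
  assumes x: "x \<in> S"
  shows "(\<lambda>z. christoffel g z u v) differentiable at x"
proof (rule differentiable_riesz[OF open_S x inner diff_g[OF x]])
  show "g z (christoffel g z u v) w = koszul z u v w" if "z \<in> S" for z w
    by (rule levi_civita_koszul[OF that levi_civita_christoffel[OF that]])
  show "(\<lambda>z. koszul z u v w) differentiable at x" for w
    unfolding koszul_def divide_inverse
    by (intro differentiable_mult differentiable_diff differentiable_add diff_dg[OF x] differentiable_const)
qed

lemma curvature_eq:
  assumes x: "x \<in> S"
  shows "curvature g x u v w =
    dirderiv (\<lambda>z. christoffel g z v w) x u - dirderiv (\<lambda>z. christoffel g z u w) x v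
    + christoffel g x u (christoffel g x v w) - christoffel g x v (christoffel g x u w)"
proof -
  have "cov_deriv g (\<lambda>_. v) (\<lambda>_. w) = (\<lambda>z. christoffel g z v w)" for v w
    by (rule ext) (simp add: cov_deriv_def)
  then show ?thesis
    by (simp add: curvature_def curvature_field_def cov_deriv_def lie_bracket_def
        bilinear_lzero[OF bilinear_christoffel[OF x]])
qed

end

text \<open>Metric compatibility of the connection pulled back along a map \<open>F\<close>. It
  serves the ambient metric along the immersion, and the induced metric with the identity in place
  of \<open>F\<close>.\<close>

lemma (in coordinate_metric) has_derivative_metric_along:
  assumes U: "open U" "y \<in> U" "\<And>z. z \<in> U \<Longrightarrow> F z \<in> S" and F: "F differentiable at y"
    and a: "a differentiable at y" and b: "b differentiable at y"
  shows "((\<lambda>z. g (F z) (a z) (b z)) has_derivative (\<lambda>u.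
    g (F y) (dirderiv a y u + christoffel g (F y) (dirderiv F y u) (a y)) (b y)
    + g (F y) (a y) (dirderiv b y u + christoffel g (F y) (dirderiv F y u) (b y)))) (at y)"
proof -
  note FU = U(3)[OF U(2)]
  interpret x: inner_form "g (F y)" by (rule inner[OF FU])
  show ?thesis
    by (rule has_derivative_eq_rhs, rule has_derivative_bilinear_family[OF U(1,2), where B = "\<lambda>z. g (F z)"])
      (use bil[OF U(3)] dirderiv_compose[OF diff_g[OF FU] F] a b in
        \<open>auto simp: christoffel_compat[OF FU] x.expand\<close>)
qed

lemma (in coordinate_metric) has_derivative_christoffel_along:
  assumes U: "open U" "y \<in> U" "\<And>z. z \<in> U \<Longrightarrow> F z \<in> S" and F: "F differentiable at y"
    and a: "a differentiable at y" and b: "b differentiable at y"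
  shows "((\<lambda>z. christoffel g (F z) (a z) (b z)) has_derivative (\<lambda>u.
    dirderiv (\<lambda>x. christoffel g x (a y) (b y)) (F y) (dirderiv F y u)
    + christoffel g (F y) (dirderiv a y u) (b y)
    + christoffel g (F y) (a y) (dirderiv b y u))) (at y)"
proof -
  note FU = U(3)[OF U(2)]
  show ?thesis
    by (rule has_derivative_eq_rhs, rule has_derivative_bilinear_family[OF U(1,2),
          where B = "\<lambda>z. christoffel g (F z)"])
      (use bilinear_christoffel[OF U(3)] dirderiv_compose[OF differentiable_christoffel[OF FU] F] a b in
        \<open>auto\<close>)
qed

section \<open>The Gauss equation\<close>

locale coordinate_immersion = ambient: coordinate_metric g T
  for g :: "'e::euclidean_space \<Rightarrow> 'e \<Rightarrow> 'e \<Rightarrow> real" and T +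
  fixes F :: "'v::euclidean_space \<Rightarrow> 'e" and S :: "'v set"
  assumes open_S: "open S" and smooth_F: "smooth_on S F"
    and range_F: "z \<in> S \<Longrightarrow> F z \<in> T" and inj_dF: "z \<in> S \<Longrightarrow> inj (dirderiv F z)"
begin

abbreviation "\<Gamma> \<equiv> christoffel g"
abbreviation "D \<equiv> cov_deriv_along g F"
abbreviation "G \<equiv> induced_metric g F"
abbreviation "tan_part \<equiv> tangential g F"
abbreviation "\<sigma> \<equiv> second_fundamental_form g F"

lemma diff_F: "z \<in> S \<Longrightarrow> F differentiable at z"
  by (rule smooth_on_differentiable[OF smooth_F])

lemma diff_dF: "z \<in> S \<Longrightarrow> (\<lambda>z. dirderiv F z v) differentiable at z"
  by (rule smooth_on_differentiable[OF smooth_on_dirderiv[OF smooth_F]])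

lemma diff_ddF: "z \<in> S \<Longrightarrow> (\<lambda>z. dirderiv (\<lambda>z. dirderiv F z v) z u) differentiable at z"
  by (rule smooth_on_differentiable[OF smooth_on_dirderiv[OF smooth_on_dirderiv[OF smooth_F]]])

lemma ddF_sym: "z \<in> S \<Longrightarrow> dirderiv (\<lambda>z. dirderiv F z v) z u = dirderiv (\<lambda>z. dirderiv F z u) z v"
  by (rule mixed_derivatives_commute[OF open_S _ smooth_F])

lemma dddF_sym: "z \<in> S \<Longrightarrow> dirderiv (\<lambda>z. dirderiv (\<lambda>z. dirderiv F z w) z v) z u =
    dirderiv (\<lambda>z. dirderiv (\<lambda>z. dirderiv F z w) z u) z v"
  by (rule mixed_derivatives_commute[OF open_S _ smooth_on_dirderiv[OF smooth_F]])

lemma lin_dF: "z \<in> S \<Longrightarrow> linear (dirderiv F z)"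
  by (rule linear_dirderiv[OF diff_F])

lemma inner_ambient: "z \<in> S \<Longrightarrow> inner_form (g (F z))"
  by (rule ambient.inner[OF range_F])

lemma inner_induced: "z \<in> S \<Longrightarrow> inner_form (G z)"
  using inner_form.pullback[OF inner_ambient lin_dF inj_dF] by (simp add: induced_metric_def[abs_def])

text \<open>Torsion-freeness along \<open>F\<close>: both the second derivatives of \<open>F\<close>
  and the Christoffel symbols are symmetric.\<close>

lemma D_sym: "z \<in> S \<Longrightarrow> D z u v = D z v u"
  by (simp add: cov_deriv_along_def ddF_sym[of z v u] ambient.christoffel_sym[OF range_F])

lemma bilinear_D:
  assumes z: "z \<in> S"
  shows "bilinear (D z)"
proof -
  note \<Gamma> = ambient.bilinear_christoffel[OF range_F[OF z]]
  have lin: "linear (\<lambda>u. D z u v)" for v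
    unfolding cov_deriv_along_def
    by (intro linear_compose_add linear_dirderiv diff_dF[OF z] linear_compose[OF lin_dF[OF z], unfolded o_def])
      (use \<Gamma> in \<open>simp add: bilinear_def\<close>)
  moreover have "D z u = (\<lambda>v. D z v u)" for u
    by (rule ext) (rule D_sym[OF z])
  ultimately have "linear (D z u)" for u
    by metis
  with lin show ?thesis by (simp add: bilinear_def)
qed

lemma has_derivative_D:
  assumes y: "y \<in> S"
  shows "((\<lambda>z. D z v w) has_derivative (\<lambda>u.
    dirderiv (\<lambda>z. dirderiv (\<lambda>z. dirderiv F z w) z v) y u
    + (dirderiv (\<lambda>x. \<Gamma> x (dirderiv F y v) (dirderiv F y w)) (F y) (dirderiv F y u)
    + \<Gamma> (F y) (dirderiv (\<lambda>z. dirderiv F z v) y u) (dirderiv F y w)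
    + \<Gamma> (F y) (dirderiv F y v) (dirderiv (\<lambda>z. dirderiv F z w) y u)))) (at y)"
  unfolding cov_deriv_along_def
  by (intro has_derivative_add has_derivative_dirderiv[OF diff_ddF[OF y]]
      ambient.has_derivative_christoffel_along[OF open_S y range_F] diff_F diff_dF y)

lemmas dD = dirderiv_eqI[OF has_derivative_D]
lemmas diff_D = differentiableI[OF has_derivative_D]

text \<open>The curvature of the pulled-back connection is the pull-back of the curvature. After
  antisymmetrising in \<open>u\<close> and \<open>v\<close>, the third derivatives of
  \<open>F\<close> and all Christoffel terms containing a second derivative of \<open>F\<close>
  cancel.\<close>

lemma curvature_along:
  assumes y: "y \<in> S"
  shows "dirderiv (\<lambda>z. D z v w) y u + \<Gamma> (F y) (dirderiv F y u) (D y v w)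
    - (dirderiv (\<lambda>z. D z u w) y v + \<Gamma> (F y) (dirderiv F y v) (D y u w))
    = curvature g (F y) (dirderiv F y u) (dirderiv F y v) (dirderiv F y w)"
  unfolding dD[OF y] ambient.curvature_eq[OF range_F[OF y]]
    dddF_sym[OF y, of w v u] ddF_sym[OF y, of v u]
  unfolding cov_deriv_along_def
  by (simp add: bilinear_radd[OF ambient.bilinear_christoffel[OF range_F[OF y]]])

lemma dG:
  assumes y: "y \<in> S"
  shows "((\<lambda>z. G z v w) has_derivative (\<lambda>u.
    g (F y) (D y u v) (dirderiv F y w) + g (F y) (dirderiv F y v) (D y u w))) (at y)"
  unfolding induced_metric_def cov_deriv_along_def
  by (intro ambient.has_derivative_metric_along[OF open_S y range_F] diff_F diff_dF y)

text \<open>By \<open>dG\<close>, the derivatives of the induced metric are inner products of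
  differentiable fields along \<open>F\<close>, hence differentiable again. All facts on Christoffel
  symbols and curvature then apply to \<open>G\<close> under the prefix \<open>sub\<close>.\<close>

sublocale sub: coordinate_metric G S
proof (rule coordinate_metric.intro)
  show "open S" by (rule open_S)
  fix x u v w :: 'v assume x: "x \<in> S"
  show "inner_form (G x)" by (rule inner_induced[OF x])
  show "(\<lambda>z. G z u v) differentiable at x" by (rule differentiableI[OF dG[OF x]])
  have "(\<lambda>z. g (F z) (D z w u) (dirderiv F z v) + g (F z) (dirderiv F z u) (D z w v)) differentiable at x"
    by (intro differentiable_add differentiableI[OF ambient.has_derivative_metric_along[OF open_S x range_F]]
        diff_F diff_dF diff_D x)
  then show "(\<lambda>z. dirderiv (\<lambda>y. G y u v) z w) differentiable at x"
    by (rule differentiable_cong_open[OF open_S x, rotated]) (simp add: dirderiv_eqI[OF dG])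
qed

section \<open>Tangential projection and second fundamental form\<close>

lemma tangential_unique:
  assumes z: "z \<in> S" and "\<And>v. g (F z) (w - dirderiv F z t) (dirderiv F z v) = 0"
  shows "tan_part z w = t"
  unfolding tangential_def
proof (rule the_equality)
  interpret inner_form "g (F z)" by (rule inner_ambient[OF z])
  interpret ind: inner_form "G z" by (rule inner_induced[OF z])
  show "\<forall>v. g (F z) (w - dirderiv F z t) (dirderiv F z v) = 0" using assms(2) by blast
  fix t' assume "\<forall>v. g (F z) (w - dirderiv F z t') (dirderiv F z v) = 0"
  with assms(2) show "t' = t"
    by (intro ind.eqI) (simp add: induced_metric_def expand)
qed

text \<open>The tangential component exists because the form
  \<open>v \<mapsto> g (F z) w (dirderiv F z v)\<close> is represented by a vector with respect to
  the induced metric.\<close>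

lemma tangential_orthogonal:
  assumes z: "z \<in> S"
  shows "g (F z) (w - dirderiv F z (tan_part z w)) (dirderiv F z v) = 0"
proof -
  interpret inner_form "g (F z)" by (rule inner_ambient[OF z])
  interpret ind: inner_form "G z" by (rule inner_induced[OF z])
  have "linear (\<lambda>v. g (F z) w (dirderiv F z v))"
    using linear_compose[OF lin_dF[OF z] lin_right] by (simp add: o_def)
  from ind.riesz[OF this] obtain t where t: "\<And>v. G z t v = g (F z) w (dirderiv F z v)" by blast
  have orth: "g (F z) (w - dirderiv F z t) (dirderiv F z v) = 0" for v
    using t[of v] by (simp add: expand induced_metric_def)
  then show ?thesis using tangential_unique[OF z orth] by simp
qed

lemma induced_tangential:
  assumes z: "z \<in> S"
  shows "G z (tan_part z w) v = g (F z) w (dirderiv F z v)"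
proof -
  interpret inner_form "g (F z)" by (rule inner_ambient[OF z])
  show ?thesis using tangential_orthogonal[OF z, of w v] by (simp add: expand induced_metric_def)
qed

text \<open>The tangential part of \<open>D\<close> is symmetric and compatible with
  \<open>G\<close>, so uniqueness of the Levi-Civita connection applies.\<close>

lemma christoffel_induced:
  assumes z: "z \<in> S"
  shows "christoffel G z = (\<lambda>u v. tan_part z (D z u v))"
proof (rule sub.christoffel_eqI[OF z])
  interpret inner_form "g (F z)" by (rule inner_ambient[OF z])
  interpret ind: inner_form "G z" by (rule inner_induced[OF z])
  note tan = induced_tangential[OF z]
  have lin: "linear (tan_part z)"
    by (rule linearI; rule ind.eqI) (simp_all add: tan expand ind.expand)
  have "bilinear (\<lambda>u v. tan_part z (D z u v))"
    using bilinear_D[OF z] linear_compose[OF _ lin] unfolding bilinear_def o_def by blast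
  moreover have "dirderiv (\<lambda>y. G y v w) z u = G z (tan_part z (D z u v)) w + G z v (tan_part z (D z u w))"
    for u v w
    unfolding ind.sym[of v "tan_part z _"] tan dirderiv_eqI[OF dG[OF z]]
    by (simp add: sym[of "dirderiv F z v"])
  ultimately show "sub.levi_civita z (\<lambda>u v. tan_part z (D z u v))"
    unfolding sub.levi_civita_def by (simp add: D_sym[OF z])
qed

lemma gauss_formula: "z \<in> S \<Longrightarrow> D z u v = \<sigma> z u v + dirderiv F z (christoffel G z u v)"
  by (simp add: second_fundamental_form_def christoffel_induced)

lemma sff_normal: "z \<in> S \<Longrightarrow> g (F z) (\<sigma> z u v) (dirderiv F z w) = 0"
  by (simp add: second_fundamental_form_def tangential_orthogonal)

lemma bilinear_sff:
  assumes z: "z \<in> S"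
  shows "bilinear (\<sigma> z)"
proof -
  have *: "\<sigma> z u v = D z u v - dirderiv F z (christoffel G z u v)" for u v
    using gauss_formula[OF z] by simp
  have "bilinear (\<lambda>u v. D z u v - dirderiv F z (christoffel G z u v))"
    using bilinear_D[OF z] sub.bilinear_christoffel[OF z] lin_dF[OF z] unfolding bilinear_def
    by (auto intro!: linear_compose_sub linear_compose[OF _ lin_dF[OF z], unfolded o_def])
  then show ?thesis by (simp add: *[abs_def])
qed

lemma sff_sym: "z \<in> S \<Longrightarrow> \<sigma> z u v = \<sigma> z v u"
  by (simp add: second_fundamental_form_def D_sym[of z u v])

text \<open>The functions \<open>g (F z) (D z v w) (dirderiv F z t)\<close> and
  \<open>G z (christoffel G z v w) t\<close> coincide on \<open>S\<close>. Differentiating the first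
  with the ambient connection and the second with the induced one, the leftover products differ by
  the pairing of second fundamental forms, since normal and tangential parts are orthogonal.\<close>

lemma ambient_cov_deriv_inner:
  assumes y: "y \<in> S"
  shows "g (F y) (dirderiv (\<lambda>z. D z v w) y u + \<Gamma> (F y) (dirderiv F y u) (D y v w)) (dirderiv F y t)
    = G y (dirderiv (\<lambda>z. christoffel G z v w) y u + christoffel G y u (christoffel G y v w)) t
      - g (F y) (\<sigma> y v w) (\<sigma> y u t)"
proof -
  interpret inner_form "g (F y)" by (rule inner_ambient[OF y])
  interpret ind: inner_form "G y" by (rule inner_induced[OF y])
  have 1: "((\<lambda>z. G z (christoffel G z v w) t) has_derivative (\<lambda>u.
      G y (dirderiv (\<lambda>z. christoffel G z v w) y u + christoffel G y u (christoffel G y v w)) t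
      + G y (christoffel G y v w) (christoffel G y u t))) (at y)"
    using sub.has_derivative_metric_along[OF open_S y, of "\<lambda>z. z" "\<lambda>z. christoffel G z v w" "\<lambda>_. t"]
      sub.differentiable_christoffel[OF y] by simp
  have 2: "((\<lambda>z. g (F z) (D z v w) (dirderiv F z t)) has_derivative (\<lambda>u.
      g (F y) (dirderiv (\<lambda>z. D z v w) y u + \<Gamma> (F y) (dirderiv F y u) (D y v w)) (dirderiv F y t)
      + g (F y) (D y v w) (D y u t))) (at y)"
    unfolding cov_deriv_along_def[of g F y u t]
    using ambient.has_derivative_metric_along[OF open_S y range_F diff_F[OF y] diff_D[OF y] diff_dF[OF y], of v w t]
    by (simp add: cov_deriv_along_def[of g F y _ t])
  have "((\<lambda>z. G z (christoffel G z v w) t) has_derivative (\<lambda>u.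
      g (F y) (dirderiv (\<lambda>z. D z v w) y u + \<Gamma> (F y) (dirderiv F y u) (D y v w)) (dirderiv F y t)
      + g (F y) (D y v w) (D y u t))) (at y)"
    by (rule has_derivative_transform_within_open[OF 2 open_S y])
      (simp add: christoffel_induced induced_tangential)
  from fun_cong[OF has_derivative_unique[OF this 1], of u]
  have "g (F y) (dirderiv (\<lambda>z. D z v w) y u + \<Gamma> (F y) (dirderiv F y u) (D y v w)) (dirderiv F y t)
    = G y (dirderiv (\<lambda>z. christoffel G z v w) y u + christoffel G y u (christoffel G y v w)) t
      + G y (christoffel G y v w) (christoffel G y u t) - g (F y) (D y v w) (D y u t)"
    by linarith
  moreover have "g (F y) (dirderiv F y a) (\<sigma> y b c) = 0" for a b c
    by (subst sym) (rule sff_normal[OF y])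
  then have "g (F y) (D y v w) (D y u t) =
      g (F y) (\<sigma> y v w) (\<sigma> y u t) + G y (christoffel G y v w) (christoffel G y u t)"
    unfolding gauss_formula[OF y]
    by (simp add: expand sff_normal[OF y] induced_metric_def)
  ultimately show ?thesis by linarith
qed

text \<open>Antisymmetrising the preceding identity in \<open>u\<close> and \<open>v\<close>
  produces the ambient curvature on one side and the intrinsic curvature on the other.\<close>

theorem gauss_equation:
  assumes y: "y \<in> S"
  shows "G y (curvature G y u v w) t =
    g (F y) (curvature g (F y) (dirderiv F y u) (dirderiv F y v) (dirderiv F y w)) (dirderiv F y t)
    + g (F y) (\<sigma> y v w) (\<sigma> y u t) - g (F y) (\<sigma> y u w) (\<sigma> y v t)"
proof -
  interpret inner_form "g (F y)" by (rule inner_ambient[OF y])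
  interpret ind: inner_form "G y" by (rule inner_induced[OF y])
  show ?thesis
    unfolding curvature_along[OF y, symmetric] expand(3)[of "_ + _" "_ + _"] ambient_cov_deriv_inner[OF y]
      sub.curvature_eq[OF y]
    by (simp add: ind.expand)
qed

lemma sectional_gauss:
  assumes y: "y \<in> S"
  shows "sectional G y u v =
    g (F y) (curvature g (F y) (dirderiv F y u) (dirderiv F y v) (dirderiv F y v)) (dirderiv F y u)
    + g (F y) (\<sigma> y u u) (\<sigma> y v v) - g (F y) (\<sigma> y u v) (\<sigma> y u v)"
  unfolding sectional_def gauss_equation[OF y]
  by (simp add: sff_sym[OF y, of v u] ambient.sym[OF range_F[OF y], of "\<sigma> y v v"])

end

section \<open>Contact metric structures in a coordinate domain\<close>

locale contact_chart =
  fixes g :: "'e::euclidean_space \<Rightarrow> 'e \<Rightarrow> 'e \<Rightarrow> real" and \<phi> :: "'e \<Rightarrow> 'e \<Rightarrow> 'e"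
    and \<xi> :: "'e \<Rightarrow> 'e" and \<eta> :: "'e \<Rightarrow> 'e \<Rightarrow> real" and T :: "'e set"
  assumes open_T: "open T"
    and inner: "x \<in> T \<Longrightarrow> inner_form (g x)"
    and lin_phi: "x \<in> T \<Longrightarrow> linear (\<phi> x)" and smooth_phi: "smooth_on T (\<lambda>x. \<phi> x u)"
    and smooth_xi: "smooth_on T \<xi>"
    and lin_eta: "x \<in> T \<Longrightarrow> linear (\<eta> x)" and smooth_eta: "smooth_on T (\<lambda>x. \<eta> x u)"
    and phi_phi: "x \<in> T \<Longrightarrow> \<phi> x (\<phi> x u) = - u + \<eta> x u *\<^sub>R \<xi> x"
    and eta_xi: "x \<in> T \<Longrightarrow> \<eta> x (\<xi> x) = 1"
    and eta_phi: "x \<in> T \<Longrightarrow> \<eta> x (\<phi> x u) = 0"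
    and phi_xi: "x \<in> T \<Longrightarrow> \<phi> x (\<xi> x) = 0"
    and metric_phi: "x \<in> T \<Longrightarrow> g x u v = g x (\<phi> x u) (\<phi> x v) + \<eta> x u * \<eta> x v"
    and metric_xi: "x \<in> T \<Longrightarrow> g x u (\<xi> x) = \<eta> x u"
    and phi_skew: "x \<in> T \<Longrightarrow> g x u (\<phi> x v) = - g x (\<phi> x u) v"
    and contact: "x \<in> T \<Longrightarrow> ext_deriv \<eta> x u v = g x u (\<phi> x v)"
begin

abbreviation "\<Phi> x u v \<equiv> g x u (\<phi> x v)"
abbreviation "d\<eta> x u v \<equiv> dirderiv (\<lambda>y. \<eta> y v) x u"
abbreviation "d\<xi> x u \<equiv> dirderiv \<xi> x u"

lemma diff_eta: "x \<in> T \<Longrightarrow> (\<lambda>y. \<eta> y v) differentiable at x"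
  by (rule smooth_on_differentiable[OF smooth_eta])

lemma diff_deta: "x \<in> T \<Longrightarrow> (\<lambda>y. d\<eta> y u v) differentiable at x"
  by (rule smooth_on_differentiable[OF smooth_on_dirderiv[OF smooth_eta]])

lemma diff_xi: "x \<in> T \<Longrightarrow> \<xi> differentiable at x"
  by (rule smooth_on_differentiable[OF smooth_xi])

lemma diff_dxi: "x \<in> T \<Longrightarrow> (\<lambda>y. d\<xi> y u) differentiable at x"
  by (rule smooth_on_differentiable[OF smooth_on_dirderiv[OF smooth_xi]])

lemma diff_phi: "x \<in> T \<Longrightarrow> (\<lambda>y. \<phi> y v) differentiable at x"
  by (rule smooth_on_differentiable[OF smooth_phi])

lemma has_derivative_eta:
  assumes "x \<in> T" "w differentiable at x"
  shows "((\<lambda>y. \<eta> y (w y)) has_derivative (\<lambda>v. d\<eta> x v (w x) + \<eta> x (dirderiv w x v))) (at x)"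
  using assms by (intro has_derivative_linear_family[OF open_T] lin_eta diff_eta)

section \<open>Lie derivatives along the Reeb field\<close>

lemma contact_deta:
  assumes x: "x \<in> T"
  shows "2 * \<Phi> x u v = d\<eta> x u v - d\<eta> x v u"
  using contact[OF x, of u v] linear_0[OF lin_eta[OF x]]
  by (simp add: ext_deriv_def lie_bracket_def)

text \<open>This is the vanishing of the Lie derivative of \<open>\<eta>\<close> along
  \<open>\<xi>\<close>, written on constant fields. By Cartan's formula it has two contributions:
  the contraction of the exterior derivative with \<open>\<xi>\<close>, zero since
  \<open>\<phi> x (\<xi> x) = 0\<close>, and the derivative of the constant function
  \<open>\<eta> y (\<xi> y)\<close>.\<close>

lemma lie_xi_eta:
  assumes x: "x \<in> T"
  shows "d\<eta> x (\<xi> x) v + \<eta> x (d\<xi> x v) = 0"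
proof -
  interpret inner_form "g x" by (rule inner[OF x])
  have "((\<lambda>y. \<eta> y (\<xi> y)) has_derivative (\<lambda>_. 0)) (at x)"
    by (rule has_derivative_transform_within_open[OF has_derivative_const[of 1] open_T x])
      (simp add: eta_xi)
  from fun_cong[OF has_derivative_unique[OF has_derivative_eta[OF x diff_xi[OF x]] this], of v]
  have "d\<eta> x v (\<xi> x) + \<eta> x (d\<xi> x v) = 0" by simp
  moreover have "\<Phi> x (\<xi> x) v = 0" using phi_skew[OF x, of "\<xi> x" v] by (simp add: phi_xi[OF x] expand)
  ultimately show ?thesis using contact_deta[OF x, of "\<xi> x" v] by simp
qed

text \<open>Lie derivative and exterior derivative commute, so the Lie derivative of
  \<open>\<Phi>\<close> along \<open>\<xi>\<close> vanishes with that of \<open>\<eta>\<close>.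
  Differentiability of \<open>\<Phi>\<close> comes from its expression by derivatives of
  \<open>\<eta>\<close>.\<close>

lemma lie_xi_Phi:
  assumes x: "x \<in> T"
  shows "((\<lambda>y. \<Phi> y u v) has_derivative dirderiv (\<lambda>y. \<Phi> y u v) x) (at x)"
    and "dirderiv (\<lambda>y. \<Phi> y u v) x (\<xi> x) + \<Phi> x (d\<xi> x u) v + \<Phi> x u (d\<xi> x v) = 0"
proof -
  have dPhi: "((\<lambda>y. \<Phi> y u v) has_derivative
      (\<lambda>w. 1/2 * (dirderiv (\<lambda>y. d\<eta> y u v) x w - dirderiv (\<lambda>y. d\<eta> y v u) x w))) (at x)"
  proof (rule has_derivative_transform_within_open[OF _ open_T x])
    show "((\<lambda>y. 1/2 * (d\<eta> y u v - d\<eta> y v u)) has_derivative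
      (\<lambda>w. 1/2 * (dirderiv (\<lambda>y. d\<eta> y u v) x w - dirderiv (\<lambda>y. d\<eta> y v u) x w))) (at x)"
      by (intro has_derivative_mult_right has_derivative_diff has_derivative_dirderiv diff_deta x)
    show "1/2 * (d\<eta> y u v - d\<eta> y v u) = \<Phi> y u v" if "y \<in> T" for y
      using contact_deta[OF that, of u v] by simp
  qed
  then show "((\<lambda>y. \<Phi> y u v) has_derivative dirderiv (\<lambda>y. \<Phi> y u v) x) (at x)"
    by (rule has_derivative_dirderiv[OF differentiableI])
  \<comment> \<open>The identity \<open>lie_xi_eta\<close>, differentiated in the direction
    \<open>u\<close>. Exchanging \<open>u\<close> and \<open>v\<close> and subtracting gives the
    claim; the second derivatives of \<open>\<xi>\<close> drop out by symmetry.\<close>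
  have *: "dirderiv (\<lambda>y. d\<eta> y u v) x (\<xi> x) + d\<eta> x (d\<xi> x u) v
      + d\<eta> x u (d\<xi> x v) + \<eta> x (dirderiv (\<lambda>y. d\<xi> y v) x u) = 0" for u v
  proof -
    have "((\<lambda>y. d\<eta> y (\<xi> y) v) has_derivative
        (\<lambda>u. dirderiv (\<lambda>y. d\<eta> y (\<xi> x) v) x u + d\<eta> x (d\<xi> x u) v)) (at x)"
      by (rule has_derivative_linear_family[OF open_T x])
        (auto intro: linear_dirderiv diff_eta diff_deta diff_xi x)
    from has_derivative_add[OF this has_derivative_eta[OF x diff_dxi[OF x], of v]]
    have "((\<lambda>y. d\<eta> y (\<xi> y) v + \<eta> y (d\<xi> y v)) has_derivative
        (\<lambda>u. dirderiv (\<lambda>y. d\<eta> y (\<xi> x) v) x u + d\<eta> x (d\<xi> x u) v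
          + (d\<eta> x u (d\<xi> x v) + \<eta> x (dirderiv (\<lambda>y. d\<xi> y v) x u)))) (at x)" .
    moreover have "((\<lambda>y. d\<eta> y (\<xi> y) v + \<eta> y (d\<xi> y v)) has_derivative (\<lambda>_. 0)) (at x)"
      by (rule has_derivative_transform_within_open[OF has_derivative_const[of 0] open_T x])
        (simp add: lie_xi_eta)
    ultimately have "(\<lambda>u. dirderiv (\<lambda>y. d\<eta> y (\<xi> x) v) x u + d\<eta> x (d\<xi> x u) v
          + (d\<eta> x u (d\<xi> x v) + \<eta> x (dirderiv (\<lambda>y. d\<xi> y v) x u))) = (\<lambda>_. 0)"
      by (rule has_derivative_unique)
    from fun_cong[OF this, of u]
    show ?thesis
      unfolding mixed_derivatives_commute[OF open_T x smooth_eta, of v "\<xi> x" u] by simp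
  qed
  have "dirderiv (\<lambda>y. \<Phi> y u v) x (\<xi> x) =
      1/2 * (dirderiv (\<lambda>y. d\<eta> y u v) x (\<xi> x) - dirderiv (\<lambda>y. d\<eta> y v u) x (\<xi> x))"
    using dirderiv_eqI[OF dPhi] by metis
  then show "dirderiv (\<lambda>y. \<Phi> y u v) x (\<xi> x) + \<Phi> x (d\<xi> x u) v + \<Phi> x u (d\<xi> x v) = 0"
    using *[of u v] *[of v u] contact_deta[OF x, of "d\<xi> x u" v] contact_deta[OF x, of u "d\<xi> x v"]
      mixed_derivatives_commute[OF open_T x smooth_xi, of u v]
    by simp
qed

abbreviation "P \<equiv> lie_deriv_endo \<xi> \<phi>"

lemma lie_phi:
  assumes x: "x \<in> T"
  shows "P x v = dirderiv (\<lambda>y. \<phi> y v) x (\<xi> x) - d\<xi> x (\<phi> x v) + \<phi> x (d\<xi> x v)"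
  by (simp add: lie_deriv_endo_def lie_bracket_def linear_neg[OF lin_phi[OF x]])

lemma linear_lie_phi:
  assumes x: "x \<in> T"
  shows "linear (P x)"
proof -
  have "P x = (\<lambda>v. dirderiv (\<lambda>y. \<phi> y v) x (\<xi> x) - d\<xi> x (\<phi> x v) + \<phi> x (d\<xi> x v))"
    by (rule ext) (rule lie_phi[OF x])
  moreover have "linear (\<lambda>v. dirderiv (\<lambda>y. \<phi> y v) x (\<xi> x))"
    by (rule linear_dirderiv_family[OF open_T x lin_phi diff_phi[OF x]])
  moreover note linear_compose[OF lin_phi[OF x] linear_dirderiv[OF diff_xi[OF x]]]
    linear_compose[OF linear_dirderiv[OF diff_xi[OF x]] lin_phi[OF x]]
  ultimately show ?thesis
    by (auto intro!: linear_compose_add linear_compose_sub simp: o_def)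
qed

lemma bilinear_Phi: "x \<in> T \<Longrightarrow> bilinear (\<Phi> x)"
  using inner_form.lin_left[OF inner] inner_form.lin_right[OF inner] lin_phi
  unfolding bilinear_def by (auto intro: linear_compose[unfolded o_def])

section \<open>Symmetry of \<open>h\<close> and of its composition with
  \<open>\<phi>\<close>\<close>

text \<open>The form \<open>B y u v = \<Phi> y u (\<phi> y v)\<close> equals minus the metric plus
  the square of \<open>\<eta>\<close>, so it is symmetric, and so is its Lie derivative along
  \<open>\<xi>\<close>. As the Lie derivative of \<open>\<Phi>\<close> is zero, the Leibniz rule
  leaves just \<open>\<Phi> x u (P x v)\<close>.\<close>

lemma phi_lie_symmetric:
  assumes x: "x \<in> T"
  shows "\<Phi> x u (P x v) = \<Phi> x v (P x u)"
proof -
  interpret inner_form "g x" by (rule inner[OF x])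
  note phi = linear_add[OF lin_phi[OF x]] linear_diff[OF lin_phi[OF x]] linear_neg[OF lin_phi[OF x]]
  define B where "B y u v = \<Phi> y u (\<phi> y v)" for y u v
  have B_sym: "B y u v = B y v u" if "y \<in> T" for y u v
  proof -
    interpret y: inner_form "g y" by (rule inner[OF that])
    show ?thesis
      by (simp add: B_def phi_phi[OF that] metric_xi[OF that] y.expand y.sym[of u v])
  qed
  have *: "\<Phi> x u (P x v) = dirderiv (\<lambda>y. B y u v) x (\<xi> x) + B x (d\<xi> x u) v + B x u (d\<xi> x v)" for u v
  proof -
    have "((\<lambda>y. \<Phi> y u (\<phi> y v)) has_derivative
        (\<lambda>w. dirderiv (\<lambda>y. \<Phi> y u (\<phi> x v)) x w + \<Phi> x u (dirderiv (\<lambda>y. \<phi> y v) x w))) (at x)"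
      by (rule has_derivative_linear_family[OF open_T x])
        (use bilinear_Phi differentiableI[OF lie_xi_Phi(1)[OF x]] diff_phi x in \<open>auto simp: bilinear_def\<close>)
    from fun_cong[OF dirderiv_eqI[OF this], of "\<xi> x"]
    have "dirderiv (\<lambda>y. B y u v) x (\<xi> x) =
        dirderiv (\<lambda>y. \<Phi> y u (\<phi> x v)) x (\<xi> x) + \<Phi> x u (dirderiv (\<lambda>y. \<phi> y v) x (\<xi> x))"
      by (simp add: B_def)
    then show ?thesis
      using lie_xi_Phi(2)[OF x, of u "\<phi> x v"]
      by (simp add: B_def lie_phi[OF x] phi expand)
  qed
  have "dirderiv (\<lambda>y. B y u v) x = dirderiv (\<lambda>y. B y v u) x"
  proof (rule dirderiv_cong_open[OF open_T x B_sym])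
    show "(\<lambda>y. B y u v) differentiable at x"
      unfolding B_def
      by (rule differentiableI, rule has_derivative_linear_family[OF open_T x])
        (use bilinear_Phi differentiableI[OF lie_xi_Phi(1)[OF x]] diff_phi x in \<open>auto simp: bilinear_def\<close>)
  qed
  then show ?thesis
    unfolding * by (simp add: B_sym[OF x, of "d\<xi> x u"] B_sym[OF x, of u])
qed

text \<open>The Lie derivative along \<open>\<xi>\<close> of the equation for the square of
  \<open>\<phi>\<close>: on the right-hand side only the Lie derivative of \<open>\<eta>\<close>
  times \<open>\<xi>\<close> could survive, and it vanishes.\<close>

lemma phi_lie_anticommute:
  assumes x: "x \<in> T"
  shows "P x (\<phi> x v) = - \<phi> x (P x v)"
proof -
  note lin = lin_phi[OF x]
  note phi = linear_add[OF lin] linear_diff[OF lin]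
  note dx = linear_diff[OF linear_dirderiv[OF diff_xi[OF x]]] linear_neg[OF linear_dirderiv[OF diff_xi[OF x]]]
    linear_cmul[OF linear_dirderiv[OF diff_xi[OF x]]]
  have "((\<lambda>y. \<phi> y (\<phi> y v)) has_derivative
      (\<lambda>w. dirderiv (\<lambda>y. \<phi> y (\<phi> x v)) x w + \<phi> x (dirderiv (\<lambda>y. \<phi> y v) x w))) (at x)"
    by (rule has_derivative_linear_family[OF open_T x lin_phi diff_phi[OF x] diff_phi[OF x]])
  moreover have "((\<lambda>y. \<phi> y (\<phi> y v)) has_derivative
      (\<lambda>w. 0 + (\<eta> x v *\<^sub>R d\<xi> x w + d\<eta> x w v *\<^sub>R \<xi> x))) (at x)"
  proof (rule has_derivative_transform_within_open[OF _ open_T x])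
    show "((\<lambda>y. - v + \<eta> y v *\<^sub>R \<xi> y) has_derivative
        (\<lambda>w. 0 + (\<eta> x v *\<^sub>R d\<xi> x w + d\<eta> x w v *\<^sub>R \<xi> x))) (at x)"
      by (intro has_derivative_add has_derivative_const has_derivative_scaleR has_derivative_dirderiv
          diff_eta diff_xi x)
  qed (simp add: phi_phi)
  ultimately have "(\<lambda>w. dirderiv (\<lambda>y. \<phi> y (\<phi> x v)) x w + \<phi> x (dirderiv (\<lambda>y. \<phi> y v) x w)) =
      (\<lambda>w. 0 + (\<eta> x v *\<^sub>R d\<xi> x w + d\<eta> x w v *\<^sub>R \<xi> x))"
    by (rule has_derivative_unique)
  from fun_cong[OF this, of "\<xi> x"]
  have *: "dirderiv (\<lambda>y. \<phi> y (\<phi> x v)) x (\<xi> x) + \<phi> x (dirderiv (\<lambda>y. \<phi> y v) x (\<xi> x)) =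
      \<eta> x v *\<^sub>R d\<xi> x (\<xi> x) + d\<eta> x (\<xi> x) v *\<^sub>R \<xi> x" by simp
  have "P x (\<phi> x v) + \<phi> x (P x v) =
      dirderiv (\<lambda>y. \<phi> y (\<phi> x v)) x (\<xi> x) + \<phi> x (dirderiv (\<lambda>y. \<phi> y v) x (\<xi> x))
      - d\<xi> x (\<phi> x (\<phi> x v)) + \<phi> x (\<phi> x (d\<xi> x v))"
    by (simp add: lie_phi[OF x] phi)
  also have "\<dots> = (d\<eta> x (\<xi> x) v + \<eta> x (d\<xi> x v)) *\<^sub>R \<xi> x"
    unfolding * phi_phi[OF x] by (simp add: dx scaleR_add_left)
  also have "\<dots> = 0" by (simp add: lie_xi_eta[OF x])
  finally show ?thesis by (simp add: eq_neg_iff_add_eq_0)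
qed

text \<open>The Lie derivative along \<open>\<xi>\<close> of
  \<open>\<eta> y (\<phi> y v) = 0\<close>, in which the Lie derivative of \<open>\<eta>\<close>
  contributes nothing.\<close>

lemma eta_lie_phi:
  assumes x: "x \<in> T"
  shows "\<eta> x (P x v) = 0"
proof -
  have "((\<lambda>y. \<eta> y (\<phi> y v)) has_derivative (\<lambda>_. 0)) (at x)"
    by (rule has_derivative_transform_within_open[OF has_derivative_const[of 0] open_T x])
      (simp add: eta_phi)
  from fun_cong[OF has_derivative_unique[OF has_derivative_eta[OF x diff_phi[OF x]] this], of "\<xi> x"]
  have "d\<eta> x (\<xi> x) (\<phi> x v) + \<eta> x (dirderiv (\<lambda>y. \<phi> y v) x (\<xi> x)) = 0" .
  then show ?thesis
    using lie_xi_eta[OF x, of "\<phi> x v"]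
    by (simp add: lie_phi[OF x] linear_add[OF lin_eta[OF x]] linear_diff[OF lin_eta[OF x]] eta_phi[OF x])
qed

text \<open>Because \<open>P x u\<close> lies in the kernel of \<open>\<eta>\<close>, applying
  \<open>\<phi>\<close> to both arguments preserves the product. This brings the claim to
  \<open>phi_lie_symmetric\<close> with \<open>\<phi> x v\<close> as an argument, and
  anticommutation removes the additional \<open>\<phi>\<close>.\<close>

lemma lie_symmetric:
  assumes x: "x \<in> T"
  shows "g x u (P x v) = g x v (P x u)"
proof -
  interpret inner_form "g x" by (rule inner[OF x])
  have "g x v (P x u) = \<Phi> x (\<phi> x v) (P x u)"
    by (simp add: metric_phi[OF x, of v "P x u"] eta_lie_phi[OF x])
  also have "\<dots> = \<Phi> x u (P x (\<phi> x v))" by (rule phi_lie_symmetric[OF x])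
  also have "\<dots> = g x u (P x v)"
    by (simp add: phi_lie_anticommute[OF x] linear_neg[OF lin_phi[OF x]] phi_phi[OF x] expand
        eta_lie_phi[OF x])
  finally show ?thesis by simp
qed

abbreviation "h \<equiv> h_op \<xi> \<phi>"

lemma linear_h: "x \<in> T \<Longrightarrow> linear (h x)"
  unfolding h_op_def by (intro linear_compose_scale_right linear_lie_phi)

lemma h_symmetric: "x \<in> T \<Longrightarrow> g x u (h x v) = g x v (h x u)"
  by (simp add: h_op_def bilinear_rmul[OF inner_form.bil[OF inner]] lie_symmetric[of x u v])

lemma phi_h_symmetric: "x \<in> T \<Longrightarrow> g x u (\<phi> x (h x v)) = g x v (\<phi> x (h x u))"
  by (simp add: h_op_def bilinear_rmul[OF inner_form.bil[OF inner]] linear_cmul[OF lin_phi]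
      phi_lie_symmetric[of x u v])

end

text \<open>Differentiating \<open>\<eta>(dF v) = 0\<close> along the submanifold shows that \<open>d\<eta>\<close> vanishes on tangent
  vectors.\<close>

lemma (in contact_chart) integral_submanifold_anti_invariant:
  fixes F :: "'v::euclidean_space \<Rightarrow> 'e"
  assumes S: "open S" "y \<in> S" and F: "smooth_on S F" and range: "\<And>z. z \<in> S \<Longrightarrow> F z \<in> T"
    and zero: "\<And>z u. z \<in> S \<Longrightarrow> \<eta> (F z) (dirderiv F z u) = 0"
  shows "g (F y) (dirderiv F y u) (\<phi> (F y) (dirderiv F y v)) = 0"
proof -
  note Fy = range[OF S(2)]
  note dF = smooth_on_differentiable[OF F S(2)]
  have *: "d\<eta> (F y) (dirderiv F y u) (dirderiv F y v)
      + \<eta> (F y) (dirderiv (\<lambda>z. dirderiv F z v) y u) = 0" for u v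
  proof -
    have "((\<lambda>z. \<eta> (F z) (dirderiv F z v)) has_derivative
        (\<lambda>u. dirderiv (\<lambda>z. \<eta> (F z) (dirderiv F y v)) y u
          + \<eta> (F y) (dirderiv (\<lambda>z. dirderiv F z v) y u))) (at y)"
      by (rule has_derivative_linear_family[OF S])
        (auto intro!: lin_eta range dirderiv_compose(2)[OF diff_eta[OF Fy] dF]
          smooth_on_differentiable[OF smooth_on_dirderiv[OF F] S(2)])
    moreover have "((\<lambda>z. \<eta> (F z) (dirderiv F z v)) has_derivative (\<lambda>_. 0)) (at y)"
      by (rule has_derivative_transform_within_open[OF has_derivative_const[of 0] S]) (simp add: zero)
    ultimately have "(\<lambda>u. dirderiv (\<lambda>z. \<eta> (F z) (dirderiv F y v)) y u
          + \<eta> (F y) (dirderiv (\<lambda>z. dirderiv F z v) y u)) = (\<lambda>_. 0)"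
      by (rule has_derivative_unique)
    from fun_cong[OF this, of u] show ?thesis
      by (simp add: dirderiv_compose(1)[OF diff_eta[OF Fy] dF])
  qed
  show ?thesis
    using *[of u v] *[of v u] contact_deta[OF Fy, of "dirderiv F y u" "dirderiv F y v"]
      mixed_derivatives_commute[OF S F, of u v]
    by simp
qed

section \<open>Orthonormal bases and the invariants \<open>\<theta>\<^sub>k\<close>\<close>

text \<open>Averaging over subsets, done one deletion at a time: each element of \<open>I\<close>
  belongs to all but one of the sets \<open>I - {i}\<close>, so summing the bounds for these sets
  counts every \<open>a i\<close> exactly \<open>card I - 1\<close> times.\<close>

lemma sum_lower_bound_from_subsets:
  fixes a :: "'i \<Rightarrow> real"
  assumes "finite I" "0 < r" "r \<le> card I"
    and "\<And>J. J \<subseteq> I \<Longrightarrow> card J = r \<Longrightarrow> real r * t \<le> sum a J"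
  shows "real (card I) * t \<le> sum a I"
  using assms(1,3,4)
proof (induction "card I" arbitrary: I rule: less_induct)
  case less
  show ?case
  proof (cases "card I = r")
    case True
    then show ?thesis using less.prems(3)[of I] by simp
  next
    case False
    with less.prems have gt: "r < card I" by simp
    have "real (card I - 1) * t \<le> sum a (I - {i})" if "i \<in> I" for i
    proof -
      have "real (card (I - {i})) * t \<le> sum a (I - {i})"
      proof (rule less.hyps)
        show "card (I - {i}) < card I" using that less.prems(1) by (rule card_Diff1_less[rotated])
        show "r \<le> card (I - {i})" using that gt by simp
        show "real r * t \<le> sum a J" if "J \<subseteq> I - {i}" "card J = r" for J
          using less.prems(3)[of J] that by blast
      qed (use less.prems(1) in simp)
      then show ?thesis using that by simp
    qed
    then have "(\<Sum>i\<in>I. real (card I - 1) * t) \<le> (\<Sum>i\<in>I. sum a (I - {i}))" by (rule sum_mono)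
    also have "\<dots> = (\<Sum>i\<in>I. sum a I - a i)"
      using less.prems(1) by (intro sum.cong) (auto simp: sum_diff1)
    also have "\<dots> = real (card I - 1) * sum a I"
      using gt by (simp add: sum_subtractf of_nat_diff algebra_simps)
    finally have "real (card I - 1) * (real (card I) * t) \<le> real (card I - 1) * sum a I"
      by (simp add: mult_ac)
    moreover have "0 < real (card I - 1)" using gt \<open>0 < r\<close> by simp
    ultimately show ?thesis by (simp only: mult_le_cancel_left_pos)
  qed
qed

context inner_form
begin

lemma independent_orthonormal:
  assumes "finite A" and ortho: "\<And>u v. u \<in> A \<Longrightarrow> v \<in> A \<Longrightarrow> b u v = (if u = v then 1 else 0)"
  shows "independent A"
proof (rule independent_if_scalars_zero[OF assms(1)])
  fix f u assume zero: "(\<Sum>x\<in>A. f x *\<^sub>R x) = 0" and u: "u \<in> A"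
  have "0 = b (\<Sum>x\<in>A. f x *\<^sub>R x) u" by (simp add: zero expand)
  also have "\<dots> = (\<Sum>x\<in>A. if x = u then f x else 0)"
    unfolding sum_left by (rule sum.cong) (auto simp: expand ortho u)
  also have "\<dots> = f u" using assms(1) u by simp
  finally show "f u = 0" by simp
qed

lemma dim_span_orthonormal:
  assumes "\<And>i j. i < k \<Longrightarrow> j < k \<Longrightarrow> b (e i) (e j) = (if i = j then 1 else 0)"
  shows "dim (span (e ` {..<k})) = k"
proof -
  have inj: "inj_on e {..<k}"
    using assms unfolding inj_on_def by (metis lessThan_iff zero_neq_one)
  have "independent (e ` {..<k})"
    by (rule independent_orthonormal) (use assms inj in \<open>auto simp: inj_on_def\<close>)
  then show ?thesis by (simp add: dim_eq_card_independent card_image[OF inj])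
qed

lemma orthonormal_expansion:
  assumes "orthonormal_basis_of b UNIV n e"
  shows "u = (\<Sum>i<n. b u (e i) *\<^sub>R e i)"
proof -
  have e: "b (e i) (e j) = (if i = j then 1 else 0)" if "i < n" "j < n" for i j
    using assms that by (simp add: orthonormal_basis_of_def)
  have lin: "linear (\<lambda>u. \<Sum>i<n. b u (e i) *\<^sub>R e i)"
    by (rule linearI) (simp_all add: expand scaleR_add_left sum.distrib scaleR_sum_right)
  have "id u = (\<Sum>i<n. b u (e i) *\<^sub>R e i)"
  proof (rule linear_eq_on_span[OF linear_id lin])
    show "u \<in> span (e ` {..<n})" using assms by (simp add: orthonormal_basis_of_def)
    fix v assume "v \<in> e ` {..<n}"
    then obtain j where j: "j < n" "v = e j" by auto
    have "(\<Sum>i<n. b v (e i) *\<^sub>R e i) = (\<Sum>i<n. if i = j then e i else 0)"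
      by (rule sum.cong) (auto simp: j e)
    then show "id v = (\<Sum>i<n. b v (e i) *\<^sub>R e i)" using j by simp
  qed
  then show ?thesis by simp
qed

text \<open>By Parseval's identity the coefficients of a unit vector in an orthonormal basis are at
  most 1 in absolute value, so the norms of the values on pairs of basis vectors add up to a
  bound.\<close>

lemma bilinear_bounded_on_unit_vectors:
  fixes B :: "'a \<Rightarrow> 'a \<Rightarrow> 'c::real_normed_vector"
  assumes e: "orthonormal_basis_of b UNIV n e" and B: "bilinear B"
  obtains K where "0 \<le> K" "\<And>u v. b u u = 1 \<Longrightarrow> b v v = 1 \<Longrightarrow> norm (B u v) \<le> K"
proof (rule that)
  have coeff: "\<bar>b u (e i)\<bar> \<le> 1" if "b u u = 1" "i < n" for u i
  proof -
    have "1 = b u (\<Sum>i<n. b u (e i) *\<^sub>R e i)"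
      using orthonormal_expansion[OF e, of u] that(1) by simp
    also have "\<dots> = (\<Sum>i<n. (b u (e i))\<^sup>2)"
      by (simp add: sum_right expand power2_eq_square)
    also have "\<dots> \<ge> (b u (e i))\<^sup>2" using that(2) by (intro member_le_sum) auto
    finally show ?thesis by (simp add: abs_square_le_1)
  qed
  show "0 \<le> (\<Sum>(i, j)\<in>{..<n} \<times> {..<n}. norm (B (e i) (e j)))"
    by (rule sum_nonneg) auto
  fix u v assume uv: "b u u = 1" "b v v = 1"
  have "B u v = B (\<Sum>i<n. b u (e i) *\<^sub>R e i) (\<Sum>i<n. b v (e i) *\<^sub>R e i)"
    using orthonormal_expansion[OF e] by simp
  also have "\<dots> = (\<Sum>(i, j)\<in>{..<n} \<times> {..<n}. B (b u (e i) *\<^sub>R e i) (b v (e j) *\<^sub>R e j))"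
    by (rule bilinear_sum[OF B])
  also have "norm \<dots> \<le> (\<Sum>(i, j)\<in>{..<n} \<times> {..<n}. norm (B (e i) (e j)))"
  proof (rule sum_norm_le)
    fix p assume "p \<in> {..<n} \<times> {..<n}"
    then obtain i j where p: "p = (i, j)" "i < n" "j < n" by auto
    then have "\<bar>b u (e i)\<bar> * \<bar>b v (e j)\<bar> \<le> 1"
      using coeff[OF uv(1), of i] coeff[OF uv(2), of j] by (simp add: mult_le_one)
    then have "(\<bar>b u (e i)\<bar> * \<bar>b v (e j)\<bar>) * norm (B (e i) (e j)) \<le> 1 * norm (B (e i) (e j))"
      by (rule mult_right_mono) simp
    then show "norm (case p of (i, j) \<Rightarrow> B (b u (e i) *\<^sub>R e i) (b v (e j) *\<^sub>R e j))
        \<le> (case p of (i, j) \<Rightarrow> norm (B (e i) (e j)))"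
      by (simp add: p(1) bilinear_lmul[OF B] bilinear_rmul[OF B] abs_mult mult_ac)
  qed
  finally show "norm (B u v) \<le> (\<Sum>(i, j)\<in>{..<n} \<times> {..<n}. norm (B (e i) (e j)))" .
qed

text \<open>Nonnegativity of the sum of squared lengths of \<open>s i i - H\<close> bounds
  \<open>n\<close> times the square of \<open>H\<close> by the diagonal squares, hence by all
  squares. The other double sum is exactly the square of \<open>real n *\<^sub>R H\<close>.\<close>

lemma mean_norm_bound:
  assumes "0 < n" and "H = (1 / real n) *\<^sub>R (\<Sum>i<n. s i i)"
  shows "(\<Sum>i<n. \<Sum>j<n. b (s i i) (s j j) - b (s i j) (s i j)) \<le> real n * (real n - 1) * b H H"
proof -
  have H: "(\<Sum>i<n. s i i) = real n *\<^sub>R H" using assms by simp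
  have "(\<Sum>i<n. \<Sum>j<n. b (s i i) (s j j)) = b (\<Sum>i<n. s i i) (\<Sum>j<n. s j j)"
    unfolding sum_left by (simp only: sum_right)
  then have 1: "(\<Sum>i<n. \<Sum>j<n. b (s i i) (s j j)) = real n * (real n * b H H)"
    by (simp add: H expand)
  have "0 \<le> (\<Sum>i<n. b (s i i - H) (s i i - H))" by (intro sum_nonneg nonneg)
  also have "\<dots> = (\<Sum>i<n. b (s i i) (s i i)) - b (\<Sum>i<n. s i i) H - b H (\<Sum>i<n. s i i) + real n * b H H"
    by (simp add: expand sum_left sum_right sum_subtractf sum.distrib)
  also have "\<dots> = (\<Sum>i<n. b (s i i) (s i i)) - real n * b H H"
    unfolding H by (simp add: expand)
  finally have "real n * b H H \<le> (\<Sum>i<n. b (s i i) (s i i))" by simp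
  also have "\<dots> \<le> (\<Sum>i<n. \<Sum>j<n. b (s i j) (s i j))"
    by (intro sum_mono member_le_sum) (auto simp: nonneg)
  finally show ?thesis using 1 by (simp add: sum_subtractf algebra_simps)
qed

end

text \<open>For a fixed \<open>i\<close>, every set of \<open>k - 1\<close> further indices spans
  together with \<open>i\<close> a \<open>k\<close>-plane whose Ricci curvature at
  \<open>e i\<close> enters the infimum; \<open>sum_lower_bound_from_subsets\<close> passes to the
  whole row. The hypothesis \<open>bound\<close> makes the set bounded below, without which
  \<open>Inf\<close> says nothing about its members.\<close>

lemma theta_k_le_sum_sectional:
  fixes G :: "'v::euclidean_space \<Rightarrow> 'v \<Rightarrow> 'v \<Rightarrow> real"
  assumes inner: "inner_form (G y)" and k: "2 \<le> k" "k \<le> n"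
    and e: "orthonormal_basis_of (G y) UNIV n e"
    and bound: "\<And>u v. G y u u = 1 \<Longrightarrow> G y v v = 1 \<Longrightarrow> G y u v = 0 \<Longrightarrow> M \<le> sectional G y u v"
  shows "real n * (real n - 1) * theta_k G y k
    \<le> (\<Sum>i<n. \<Sum>j\<in>{..<n} - {i}. sectional G y (e i) (e j))"
proof -
  interpret inner_form "G y" by (rule inner)
  define \<Omega> where "\<Omega> = {plane_ricci G y k e | P U e.
            subspace P \<and> dim P = k \<and> U \<in> P \<and> G y U U = 1 \<and>
            orthonormal_basis_of (G y) P k e \<and> e 0 = U}"
  have theta: "(real k - 1) * theta_k G y k = Inf \<Omega>"
    using k by (simp add: theta_k_def \<Omega>_def)
  have "real (k - 1) * M \<le> r" if "r \<in> \<Omega>" for r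
  proof -
    from that obtain P e' where e': "orthonormal_basis_of (G y) P k e'" "r = plane_ricci G y k e'"
      by (auto simp: \<Omega>_def)
    have "(\<Sum>j=1..<k. M) \<le> plane_ricci G y k e'"
      unfolding plane_ricci_def
      by (intro sum_mono bound) (use e'(1) k in \<open>auto simp: orthonormal_basis_of_def\<close>)
    then show ?thesis by (simp add: e'(2))
  qed
  then have bdd: "bdd_below \<Omega>" by (auto simp: bdd_below_def)
  have orth: "G y (e i) (e j) = (if i = j then 1 else 0)" if "i < n" "j < n" for i j
    using e that by (simp add: orthonormal_basis_of_def)
  have row: "real (n - 1) * theta_k G y k \<le> (\<Sum>j\<in>{..<n} - {i}. sectional G y (e i) (e j))"
    if i: "i < n" for i
  proof -
    have "real (card ({..<n} - {i})) * theta_k G y k \<le> (\<Sum>j\<in>{..<n} - {i}. sectional G y (e i) (e j))"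
    proof (rule sum_lower_bound_from_subsets[where r = "k - 1"])
      show "k - 1 \<le> card ({..<n} - {i})" using k i by simp
      fix J assume J: "J \<subseteq> {..<n} - {i}" "card J = k - 1"
      have "finite J" using J(1) finite_subset by blast
      then obtain f where f: "bij_betw f {1..<k} J"
        using finite_same_card_bij[of "{1..<k}" J] J(2) by auto
      \<comment> \<open>Position 0 is reserved for \<open>i\<close>, as \<open>plane_ricci\<close>
        measures at the vector of index 0; the positions from 1 to \<open>k - 1\<close> enumerate
        \<open>J\<close>.\<close>
      define f' where "f' j = (if j = 0 then i else f j)" for j :: nat
      define e' where "e' = e \<circ> f'"
      have f_mem: "f a < n" "f a \<noteq> i" if "a < k" "a \<noteq> 0" for a
        using that J(1) bij_betwE[OF f] by force+
      have f_inj: "f a = f c \<longleftrightarrow> a = c" if "a < k" "a \<noteq> 0" "c < k" "c \<noteq> 0" for a c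
        using that inj_on_eq_iff[OF bij_betw_imp_inj_on[OF f], of a c] by simp
      have f'_less: "f' a < n" if "a < k" for a
        using that i f_mem(1) by (simp add: f'_def)
      have f'_inj: "f' a = f' c \<longleftrightarrow> a = c" if "a < k" "c < k" for a c
        using that f_mem(2) f_inj by (auto simp: f'_def)
      have orth': "G y (e' a) (e' c) = (if a = c then 1 else 0)" if "a < k" "c < k" for a c
        using that by (simp add: e'_def orth f'_less f'_inj)
      have basis: "orthonormal_basis_of (G y) (span (e' ` {..<k})) k e'"
        using orth' by (simp add: orthonormal_basis_of_def)
      have "plane_ricci G y k e' \<in> \<Omega>"
        unfolding \<Omega>_def mem_Collect_eq
      proof (intro exI conjI)
        show "dim (span (e' ` {..<k})) = k" by (rule dim_span_orthonormal[OF orth'])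
        show "e' 0 \<in> span (e' ` {..<k})" using k by (intro span_base) auto
        show "G y (e' 0) (e' 0) = 1" using orth'[of 0 0] k by simp
      qed (rule refl subspace_span basis)+
      then have "Inf \<Omega> \<le> plane_ricci G y k e'" by (rule cInf_lower[OF _ bdd])
      also have "\<dots> = (\<Sum>j=1..<k. sectional G y (e i) (e (f j)))"
        unfolding plane_ricci_def by (rule sum.cong) (auto simp: e'_def f'_def)
      also have "\<dots> = (\<Sum>j\<in>J. sectional G y (e i) (e j))"
        using f by (rule sum.reindex_bij_betw)
      finally show "real (k - 1) * theta_k G y k \<le> (\<Sum>j\<in>J. sectional G y (e i) (e j))"
        using theta k by (simp add: of_nat_diff)
    qed (use k in auto)
    then show ?thesis using i by simp
  qed
  have "(\<Sum>i<n. real (n - 1) * theta_k G y k) \<le> (\<Sum>i<n. \<Sum>j\<in>{..<n} - {i}. sectional G y (e i) (e j))"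
    by (rule sum_mono) (use row in simp)
  then show ?thesis using k by (simp add: of_nat_diff mult.assoc)
qed

text \<open>The full double sum minus its diagonal. On the diagonal the \<open>c5\<close> and
  \<open>c6\<close> expressions cancel and \<open>S\<close> is zero, so only
  \<open>c1 + 2 * c4 * A i i\<close> is subtracted.\<close>

lemma sum_off_diagonal:
  fixes A B S :: "nat \<Rightarrow> nat \<Rightarrow> real"
  assumes "\<And>i. S i i = 0"
  shows "(\<Sum>i<n. \<Sum>j\<in>{..<n} - {i}. c1 + c4 * (A i i + A j j) + c5 * (A i i * A j j - (A i j)\<^sup>2)
      + c6 * (B i i * B j j - (B i j)\<^sup>2) + S i j)
    = real n * (real n - 1) * c1 + 2 * (real n - 1) * c4 * (\<Sum>i<n. A i i)
      + c5 * ((\<Sum>i<n. A i i)\<^sup>2 - (\<Sum>i<n. \<Sum>j<n. (A i j)\<^sup>2))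
      + c6 * ((\<Sum>i<n. B i i)\<^sup>2 - (\<Sum>i<n. \<Sum>j<n. (B i j)\<^sup>2)) + (\<Sum>i<n. \<Sum>j<n. S i j)"
proof -
  define t where "t i j = c1 + c4 * (A i i + A j j) + c5 * (A i i * A j j - (A i j)\<^sup>2)
      + c6 * (B i i * B j j - (B i j)\<^sup>2) + S i j" for i j
  have "(\<Sum>i<n. \<Sum>j\<in>{..<n} - {i}. t i j) = (\<Sum>i<n. (\<Sum>j<n. t i j) - t i i)"
    by (rule sum.cong) (auto simp: sum_diff1)
  also have "\<dots> = (\<Sum>i<n. \<Sum>j<n. t i j) - (\<Sum>i<n. c1 + 2 * c4 * A i i)"
    unfolding sum_subtractf by (simp add: t_def assms power2_eq_square algebra_simps)
  also have "(\<Sum>i<n. \<Sum>j<n. t i j) = real n * (real n * c1) + c4 * (2 * (real n * (\<Sum>i<n. A i i)))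
      + c5 * ((\<Sum>i<n. A i i)\<^sup>2 - (\<Sum>i<n. \<Sum>j<n. (A i j)\<^sup>2))
      + c6 * ((\<Sum>i<n. B i i)\<^sup>2 - (\<Sum>i<n. \<Sum>j<n. (B i j)\<^sup>2)) + (\<Sum>i<n. \<Sum>j<n. S i j)"
    by (simp add: t_def sum.distrib sum_subtractf flip: sum_distrib_left sum_distrib_right)
      (simp add: power2_eq_square sum_product sum_distrib_left algebra_simps)
  also have "(\<Sum>i<n. c1 + 2 * c4 * A i i) = real n * c1 + 2 * c4 * (\<Sum>i<n. A i i)"
    by (simp add: sum.distrib sum_distrib_left)
  finally show ?thesis by (simp add: t_def algebra_simps)
qed

section \<open>\<open>C\<close>-totally real submanifolds of generalized space forms\<close>

lemma abs_product_diff_square_le: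
  fixes p q r K :: real
  assumes "\<bar>p\<bar> \<le> K" "\<bar>q\<bar> \<le> K" "\<bar>r\<bar> \<le> K"
  shows "\<bar>p * q - r\<^sup>2\<bar> \<le> 2 * K\<^sup>2"
proof -
  have "\<bar>p * q\<bar> \<le> K * K" "\<bar>r * r\<bar> \<le> K * K"
    unfolding abs_mult by (intro mult_mono; use assms in linarith)+
  then show ?thesis unfolding power2_eq_square by linarith
qed

text \<open>The curvature formula is imposed at the single point \<open>y\<close>, with the values
  of the coefficient functions there. Normality of \<open>\<xi>\<close> is imposed on all of
  \<open>S\<close> because it gets differentiated in \<open>anti_invariant\<close>.\<close>

locale C_totally_real_chart =
  coordinate_immersion g T F S + contact: contact_chart g \<phi> \<xi> \<eta> T
  for g :: "'e::euclidean_space \<Rightarrow> 'e \<Rightarrow> 'e \<Rightarrow> real" and T and F :: "'v::euclidean_space \<Rightarrow> 'e" and S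
    and \<phi> \<xi> \<eta> +
  fixes y :: 'v and c1 c2 c3 c4 c51 c52 c6 :: real
  assumes y: "y \<in> S"
    and normal_xi: "z \<in> S \<Longrightarrow> g (F z) (\<xi> (F z)) (dirderiv F z t) = 0"
    and space_form: "curvature g (F y) u v w =
      c1 *\<^sub>R R1 (g (F y)) u v w + c2 *\<^sub>R R2 (g (F y)) (\<phi> (F y)) u v w
      + c3 *\<^sub>R R3 (g (F y)) (\<xi> (F y)) (\<eta> (F y)) u v w
      + c4 *\<^sub>R R4 (g (F y)) (h_op \<xi> \<phi> (F y)) u v w
      + c51 *\<^sub>R R51 (g (F y)) (h_op \<xi> \<phi> (F y)) u v w
      + c52 *\<^sub>R R52 (g (F y)) (\<phi> (F y)) (h_op \<xi> \<phi> (F y)) u v w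
      + c6 *\<^sub>R R6 (g (F y)) (\<xi> (F y)) (\<eta> (F y)) (h_op \<xi> \<phi> (F y)) u v w"
begin

lemma Fy: "F y \<in> T"
  by (rule range_F[OF y])

lemma eta_tangent: "z \<in> S \<Longrightarrow> \<eta> (F z) (dirderiv F z u) = 0"
  using normal_xi[of z u] contact.metric_xi[OF range_F, of z] ambient.sym[OF range_F, of z]
  by metis

lemma anti_invariant: "g (F y) (dirderiv F y u) (\<phi> (F y) (dirderiv F y v)) = 0"
  by (rule contact.integral_submanifold_anti_invariant[OF open_S y smooth_F range_F eta_tangent])

text \<open>\<open>A\<close> and \<open>B\<close> below are the forms of \<open>h\<close> and of its
  composition with \<open>\<phi>\<close>, pulled back to the submanifold. The curvature terms,
  traces and squared norms are all expressed by them, without the tangential projection.\<close>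

definition A :: "'v \<Rightarrow> 'v \<Rightarrow> real" where
  "A u v = g (F y) (dirderiv F y u) (h_op \<xi> \<phi> (F y) (dirderiv F y v))"

definition B :: "'v \<Rightarrow> 'v \<Rightarrow> real" where
  "B u v = g (F y) (dirderiv F y u) (\<phi> (F y) (h_op \<xi> \<phi> (F y) (dirderiv F y v)))"

lemma A_sym: "A u v = A v u"
  unfolding A_def by (rule contact.h_symmetric[OF Fy])

lemma B_sym: "B u v = B v u"
  unfolding B_def by (rule contact.phi_h_symmetric[OF Fy])

lemma bilinear_pullback:
  assumes "linear Q"
  shows "bilinear (\<lambda>u v. g (F y) (dirderiv F y u) (Q (dirderiv F y v)))"
proof -
  interpret inner_form "g (F y)" by (rule inner_ambient[OF y])
  show ?thesis
    unfolding bilinear_def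
    by (auto intro!: linearI simp: linear_add[OF lin_dF[OF y]] linear_cmul[OF lin_dF[OF y]]
        linear_add[OF assms] linear_cmul[OF assms] expand)
qed

lemma bilinear_A: "bilinear A"
  unfolding A_def[abs_def] by (rule bilinear_pullback[OF contact.linear_h[OF Fy]])

lemma bilinear_B: "bilinear B"
  unfolding B_def[abs_def]
  using bilinear_pullback[OF linear_compose[OF contact.linear_h[OF Fy] contact.lin_phi[OF Fy]]]
  by (simp add: o_def)

definition gauss_term :: "'v \<Rightarrow> 'v \<Rightarrow> real" where
  "gauss_term u v = g (F y) (\<sigma> y u u) (\<sigma> y v v) - g (F y) (\<sigma> y u v) (\<sigma> y u v)"

text \<open>Substitution of the space form curvature into the Gauss equation. The tensors
  \<open>R3\<close> and \<open>R6\<close> contribute nothing because \<open>\<eta>\<close> vanishes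
  on tangent vectors, nor does \<open>R2\<close> by \<open>anti_invariant\<close>; symmetry of
  \<open>A\<close> and \<open>B\<close> turns the mixed products of \<open>R51\<close> and
  \<open>R52\<close> into squares.\<close>

lemma sectional_induced:
  assumes "G y u u = 1" "G y v v = 1" "G y u v = 0"
  shows "sectional G y u v = c1 + c4 * (A u u + A v v) + c51 * (A u u * A v v - (A u v)\<^sup>2)
    + c52 * (B u u * B v v - (B u v)\<^sup>2) + gauss_term u v"
proof -
  interpret inner_form "g (F y)" by (rule inner_ambient[OF y])
  define X where "X = dirderiv F y u"
  define Y where "Y = dirderiv F y v"
  define hh where "hh = h_op \<xi> \<phi> (F y)"
  have uv: "g (F y) X X = 1" "g (F y) Y Y = 1" "g (F y) X Y = 0" "g (F y) Y X = 0"
    using assms sym unfolding X_def Y_def induced_metric_def by metis+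
  have anti: "g (F y) X (\<phi> (F y) Y) = 0" "g (F y) Y (\<phi> (F y) Y) = 0"
    by (simp_all add: X_def Y_def anti_invariant)
  have eta: "\<eta> (F y) X = 0" "\<eta> (F y) Y = 0"
    by (simp_all add: X_def Y_def eta_tangent[OF y])
  have AB: "g (F y) (hh X) X = A u u" "g (F y) (hh Y) Y = A v v"
    "g (F y) (hh X) Y = A u v" "g (F y) (hh Y) X = A u v"
    "g (F y) (\<phi> (F y) (hh X)) X = B u u" "g (F y) (\<phi> (F y) (hh Y)) Y = B v v"
    "g (F y) (\<phi> (F y) (hh X)) Y = B u v" "g (F y) (\<phi> (F y) (hh Y)) X = B u v"
    using sym A_sym B_sym unfolding A_def B_def X_def Y_def hh_def by metis+
  have "g (F y) (curvature g (F y) X Y Y) X = c1 + c4 * (A u u + A v v)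
      + c51 * (A u u * A v v - (A u v)\<^sup>2) + c52 * (B u u * B v v - (B u v)\<^sup>2)"
    unfolding space_form R1_def R2_def R3_def R4_def R51_def R52_def R6_def hh_def[symmetric]
    by (simp add: uv anti eta AB expand power2_eq_square algebra_simps)
  then show ?thesis
    unfolding sectional_gauss[OF y] gauss_term_def X_def Y_def by simp
qed

text \<open>Provides the bound that makes the infimum in \<open>theta_k\<close> meaningful: the
  forms \<open>A\<close>, \<open>B\<close> and \<open>\<sigma> y\<close> are bounded on unit
  vectors, and the sectional curvature is a polynomial expression in their values and the ambient
  products.\<close>

lemma sectional_induced_bounded_below:
  assumes e: "orthonormal_basis_of (G y) UNIV n e"
  obtains M where "\<And>u v. G y u u = 1 \<Longrightarrow> G y v v = 1 \<Longrightarrow> G y u v = 0 \<Longrightarrow> M \<le> sectional G y u v"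
proof -
  interpret ind: inner_form "G y" by (rule inner_induced[OF y])
  obtain a where a: "\<And>u v. G y u u = 1 \<Longrightarrow> G y v v = 1 \<Longrightarrow> norm (A u v) \<le> a"
    using ind.bilinear_bounded_on_unit_vectors[OF e bilinear_A] by metis
  obtain b where b: "\<And>u v. G y u u = 1 \<Longrightarrow> G y v v = 1 \<Longrightarrow> norm (B u v) \<le> b"
    using ind.bilinear_bounded_on_unit_vectors[OF e bilinear_B] by metis
  obtain s where s: "0 \<le> s" "\<And>u v. G y u u = 1 \<Longrightarrow> G y v v = 1 \<Longrightarrow> norm (\<sigma> y u v) \<le> s"
    using ind.bilinear_bounded_on_unit_vectors[OF e bilinear_sff[OF y]] by metis
  obtain r where r: "\<And>v w. norm (g (F y) v w) \<le> r * norm v * norm w"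
    using bilinear_bounded[OF ambient.bil[OF Fy]] by blast
  have g: "\<bar>g (F y) v w\<bar> \<le> \<bar>r\<bar> * (s * s)" if "norm v \<le> s" "norm w \<le> s" for v w
  proof -
    have "\<bar>g (F y) v w\<bar> \<le> r * (norm v * norm w)" using r[of v w] by (simp add: mult.assoc)
    also have "\<dots> \<le> \<bar>r\<bar> * (norm v * norm w)" by (intro mult_right_mono) auto
    also have "\<dots> \<le> \<bar>r\<bar> * (s * s)" using that s(1) by (intro mult_left_mono mult_mono) auto
    finally show ?thesis .
  qed
  have prod: "\<bar>c * t\<bar> \<le> \<bar>c\<bar> * K" if "\<bar>t\<bar> \<le> K" for c t K :: real
    unfolding abs_mult by (rule mult_left_mono[OF that]) simp
  show ?thesis
  proof (rule that)
    fix u v assume uv: "G y u u = 1" "G y v v = 1" "G y u v = 0"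
    have "\<bar>A u u + A v v\<bar> \<le> 2 * a" using a[OF uv(1) uv(1)] a[OF uv(2) uv(2)] by simp
    from prod[OF this, of c4]
      prod[OF abs_product_diff_square_le[OF a[OF uv(1,1), simplified] a[OF uv(2,2), simplified]
          a[OF uv(1,2), simplified]], of c51]
      prod[OF abs_product_diff_square_le[OF b[OF uv(1,1), simplified] b[OF uv(2,2), simplified]
          b[OF uv(1,2), simplified]], of c52]
      g[OF s(2)[OF uv(1,1)] s(2)[OF uv(2,2)]] g[OF s(2)[OF uv(1,2)] s(2)[OF uv(1,2)]]
    show "c1 - \<bar>c4\<bar> * (2 * a) - \<bar>c51\<bar> * (2 * a\<^sup>2) - \<bar>c52\<bar> * (2 * b\<^sup>2) - \<bar>r\<bar> * (s * s) - \<bar>r\<bar> * (s * s)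
        \<le> sectional G y u v"
      unfolding sectional_induced[OF uv] gauss_term_def abs_le_iff by linarith
  qed
qed

text \<open>Pairing with a tangent vector does not see the normal component, so the projection
  disappears from traces and norms.\<close>

lemma trace_tangential_part:
  assumes "orthonormal_basis_of (G y) UNIV DIM('v) e"
  shows "trace_wrt (G y) e (tangential_part g F y Q) =
      (\<Sum>i<DIM('v). g (F y) (dirderiv F y (e i)) (Q (dirderiv F y (e i))))"
    and "sqnorm_wrt (G y) e (tangential_part g F y Q) =
      (\<Sum>i<DIM('v). \<Sum>j<DIM('v). (g (F y) (dirderiv F y (e i)) (Q (dirderiv F y (e j))))\<^sup>2)"
  unfolding trace_wrt_def sqnorm_wrt_def tangential_part_def
    sub.sym[OF y, of _ "tan_part y _"] induced_tangential[OF y] ambient.sym[OF Fy, of "Q _"]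
  by (rule refl)+

text \<open>The inequality in coordinates at one point: the sectional curvatures are summed over all
  ordered pairs of distinct basis vectors, bounded below through \<open>theta_k\<close>, and
  evaluated by the Gauss equation with the second fundamental form estimated by
  \<open>H\<close>.\<close>

theorem chen_ricci_inequality:
  fixes n k :: nat and e :: "nat \<Rightarrow> 'v" and H :: 'e
  defines "H \<equiv> mean_curvature_vector g F y e"
    and "hT \<equiv> tangential_part g F y (h_op \<xi> \<phi> (F y))"
    and "\<phi>hT \<equiv> tangential_part g F y (\<phi> (F y) \<circ> h_op \<xi> \<phi> (F y))"
  assumes n: "DIM('v) = n" and k: "2 \<le> k" "k \<le> n" and e: "orthonormal_basis_of (G y) UNIV n e"
  shows "real n * (real n - 1) * theta_k G y k
      - real n * (real n - 1) * c1 - 2 * (real n - 1) * c4 * trace_wrt (G y) e hT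
      - c51 * ((trace_wrt (G y) e hT)\<^sup>2 - sqnorm_wrt (G y) e hT)
      + c52 * (sqnorm_wrt (G y) e \<phi>hT - (trace_wrt (G y) e \<phi>hT)\<^sup>2)
    \<le> real n * (real n - 1) * g (F y) H H"
proof -
  interpret inner_form "g (F y)" by (rule inner_ambient[OF y])
  have orth: "G y (e i) (e j) = (if i = j then 1 else 0)" if "i < n" "j < n" for i j
    using e that by (simp add: orthonormal_basis_of_def)
  note tr = trace_tangential_part[OF e[folded n], unfolded n]
  have traces: "trace_wrt (G y) e hT = (\<Sum>i<n. A (e i) (e i))"
    "sqnorm_wrt (G y) e hT = (\<Sum>i<n. \<Sum>j<n. (A (e i) (e j))\<^sup>2)"
    "trace_wrt (G y) e \<phi>hT = (\<Sum>i<n. B (e i) (e i))"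
    "sqnorm_wrt (G y) e \<phi>hT = (\<Sum>i<n. \<Sum>j<n. (B (e i) (e j))\<^sup>2)"
    by (simp_all add: tr hT_def \<phi>hT_def A_def B_def)
  obtain M where M: "\<And>u v. G y u u = 1 \<Longrightarrow> G y v v = 1 \<Longrightarrow> G y u v = 0 \<Longrightarrow> M \<le> sectional G y u v"
    using sectional_induced_bounded_below[OF e] by blast
  have "real n * (real n - 1) * theta_k G y k
      \<le> (\<Sum>i<n. \<Sum>j\<in>{..<n} - {i}. sectional G y (e i) (e j))"
    by (rule theta_k_le_sum_sectional[OF inner_induced[OF y] k e M])
  also have "\<dots> = (\<Sum>i<n. \<Sum>j\<in>{..<n} - {i}. c1 + c4 * (A (e i) (e i) + A (e j) (e j))
      + c51 * (A (e i) (e i) * A (e j) (e j) - (A (e i) (e j))\<^sup>2)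
      + c52 * (B (e i) (e i) * B (e j) (e j) - (B (e i) (e j))\<^sup>2) + gauss_term (e i) (e j))"
    by (intro sum.cong refl sectional_induced) (auto simp: orth)
  also have "\<dots> = real n * (real n - 1) * c1 + 2 * (real n - 1) * c4 * trace_wrt (G y) e hT
      + c51 * ((trace_wrt (G y) e hT)\<^sup>2 - sqnorm_wrt (G y) e hT)
      + c52 * ((trace_wrt (G y) e \<phi>hT)\<^sup>2 - sqnorm_wrt (G y) e \<phi>hT)
      + (\<Sum>i<n. \<Sum>j<n. gauss_term (e i) (e j))"
    unfolding traces by (rule sum_off_diagonal) (simp add: gauss_term_def)
  also have "(\<Sum>i<n. \<Sum>j<n. gauss_term (e i) (e j)) \<le> real n * (real n - 1) * g (F y) H H"
    unfolding gauss_term_def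
    by (rule mean_norm_bound[where s = "\<lambda>i j. \<sigma> y (e i) (e j)"])
      (use k in \<open>simp_all add: H_def mean_curvature_vector_def n\<close>)
  finally show ?thesis by (simp add: algebra_simps)
qed

end

section \<open>From manifolds to coordinates\<close>

lemma coordinate_metric_chart:
  assumes "smooth_manifold X A" "riemannian_metric A g" "C \<in> A"
  shows "coordinate_metric (g C) (chart_image C)"
proof (rule coordinate_metric.intro)
  show "open (chart_image C)" using assms by (simp add: smooth_manifold_def)
  have smooth: "smooth_on (chart_image C) (\<lambda>x. g C x u v)" for u v
    using assms by (simp add: riemannian_metric_def)
  fix x u v w assume x: "x \<in> chart_image C"
  show "inner_form (g C x)"
    by (rule inner_form.intro) (use assms x in \<open>auto simp: riemannian_metric_def\<close>)
  show "(\<lambda>z. g C z u v) differentiable at x" by (rule smooth_on_differentiable[OF smooth x])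
  show "(\<lambda>z. dirderiv (\<lambda>y. g C y u v) z w) differentiable at x"
    by (rule smooth_on_differentiable[OF smooth_on_dirderiv[OF smooth] x])
qed

lemma contact_chart_of_contact_metric:
  assumes "contact_metric X A \<phi> \<xi> \<eta> g" and C: "C \<in> A"
  shows "contact_chart (g C) (\<phi> C) (\<xi> C) (\<eta> C) (chart_image C)"
proof -
  have acm: "almost_contact_metric X A \<phi> \<xi> \<eta> g"
    and contact: "\<And>x u v. x \<in> chart_image C \<Longrightarrow> ext_deriv (\<eta> C) x u v = g C x u (\<phi> C x v)"
    using assms by (auto simp: contact_metric_def)
  have fields: "smooth_manifold X A" "endomorphism_field A \<phi>" "vector_field A \<xi>" "one_form A \<eta>"
      "riemannian_metric A g"
    using acm unfolding almost_contact_metric_def by blast+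
  interpret coordinate_metric "g C" "chart_image C"
    by (rule coordinate_metric_chart[OF fields(1,5) C])
  have tensors: "smooth_on (chart_image C) (\<lambda>x. \<phi> C x u)" "smooth_on (chart_image C) (\<xi> C)"
    "smooth_on (chart_image C) (\<lambda>x. \<eta> C x u)" for u
    using fields C by (auto simp: endomorphism_field_def vector_field_def one_form_def)
  have linear: "linear (\<phi> C x)" "linear (\<eta> C x)" if "x \<in> chart_image C" for x
    using fields C that by (auto simp: endomorphism_field_def one_form_def)
  have algebra: "\<forall>u. \<phi> C x (\<phi> C x u) = - u + \<eta> C x u *\<^sub>R \<xi> C x"
      "\<eta> C x (\<xi> C x) = 1" "\<forall>u. \<eta> C x (\<phi> C x u) = 0" "\<phi> C x (\<xi> C x) = 0"
      "\<forall>u v. g C x u v = g C x (\<phi> C x u) (\<phi> C x v) + \<eta> C x u * \<eta> C x v"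
      "\<forall>u. g C x u (\<xi> C x) = \<eta> C x u"
      "\<forall>u v. g C x u (\<phi> C x v) = - g C x (\<phi> C x u) v" if "x \<in> chart_image C" for x
    using acm C that unfolding almost_contact_metric_def by blast+
  show ?thesis
    by (rule contact_chart.intro) (fact open_S inner tensors linear contact | use algebra in blast)+
qed

lemma chart_inv_coords:
  assumes "smooth_manifold Y B" "c \<in> B" "q \<in> chart_dom c"
  shows "chart_inv c (coords c q) = q"
proof -
  have "openin Y (chart_dom c)"
    "homeomorphic_map (subtopology Y (chart_dom c)) (top_of_set (chart_image c)) (coords c)"
    using assms by (auto simp: smooth_manifold_def)
  then have "inj_on (coords c) (chart_dom c)"
    using homeomorphic_imp_injective_map openin_subset by (metis topspace_subtopology_subset)
  then show ?thesis using assms(3) by (simp add: chart_inv_def)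
qed

text \<open>The set is the image, under the homeomorphism \<open>coords c\<close>, of an open part
  of the chart domain. It is thus relatively open in \<open>chart_image c\<close>, which is itself
  open in the model space.\<close>

lemma open_local_dom:
  assumes Y: "smooth_manifold Y B" and X: "smooth_manifold X A" and f: "continuous_map Y X f"
    and c: "c \<in> B" and C: "C \<in> A"
  shows "open (local_dom c C f)"
proof -
  have c': "openin Y (chart_dom c)" "open (chart_image c)"
    "homeomorphic_map (subtopology Y (chart_dom c)) (top_of_set (chart_image c)) (coords c)"
    using Y c by (auto simp: smooth_manifold_def)
  have "openin X (chart_dom C)" using X C by (simp add: smooth_manifold_def)
  then have "openin Y {q \<in> topspace Y. f q \<in> chart_dom C}"
    by (rule openin_continuous_map_preimage[OF f])
  then have "openin (subtopology Y (chart_dom c)) (chart_dom c \<inter> {q \<in> topspace Y. f q \<in> chart_dom C})"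
    by (rule openin_subtopology_Int2)
  moreover have "chart_dom c \<inter> {q \<in> topspace Y. f q \<in> chart_dom C} = {q \<in> chart_dom c. f q \<in> chart_dom C}"
    using openin_subset[OF c'(1)] by auto
  ultimately have "openin (subtopology Y (chart_dom c)) {q \<in> chart_dom c. f q \<in> chart_dom C}" by simp
  then have "openin (top_of_set (chart_image c)) (local_dom c C f)"
    using homeomorphic_imp_open_map[OF c'(3)] unfolding open_map_def local_dom_def by blast
  then show ?thesis using c'(2) by (simp add: openin_open_eq)
qed

lemma coordinate_immersion_chart:
  assumes X: "smooth_manifold X A" and g: "riemannian_metric A g"
    and f: "immersed_submanifold Y B X A f" and c: "c \<in> B" and C: "C \<in> A"
  shows "coordinate_immersion (g C) (chart_image C) (local_map c C f) (local_dom c C f)"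
proof -
  have Y: "smooth_manifold Y B" and cont: "continuous_map Y X f"
    using f by (auto simp: immersed_submanifold_def)
  interpret coordinate_metric "g C" "chart_image C" by (rule coordinate_metric_chart[OF X g C])
  show ?thesis
  proof unfold_locales
    show "open (local_dom c C f)" by (rule open_local_dom[OF Y X cont c C])
    show "smooth_on (local_dom c C f) (local_map c C f)"
      using f c C by (simp add: immersed_submanifold_def)
    fix z assume z: "z \<in> local_dom c C f"
    then show "inj (dirderiv (local_map c C f) z)"
      using f c C by (simp add: immersed_submanifold_def)
    from z show "local_map c C f z \<in> chart_image C"
      using chart_inv_coords[OF Y c] by (auto simp: local_dom_def local_map_def chart_image_def)
  qed
qed

text \<open>The charts around \<open>p\<close> and its image as well as the orthonormal basis
  \<open>e\<close> are arbitrary, so the inequality holds for every coordinate representation of the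
  quantities involved.\<close>

theorem theorem5p2:
  fixes X :: "'a topology" and A :: "('a, 'e::euclidean_space) chart set"
    and Y :: "'b topology" and B :: "('b, 'v::euclidean_space) chart set"
    and \<iota> :: "'b \<Rightarrow> 'a"
    and \<phi> :: "('a, 'e) chart \<Rightarrow> 'e \<Rightarrow> 'e \<Rightarrow> 'e" and \<xi> :: "('a, 'e) chart \<Rightarrow> 'e \<Rightarrow> 'e"
    and \<eta> :: "('a, 'e) chart \<Rightarrow> 'e \<Rightarrow> 'e \<Rightarrow> real" and g :: "('a, 'e) chart \<Rightarrow> 'e \<Rightarrow> 'e \<Rightarrow> 'e \<Rightarrow> real"
    and f1 f2 f3 f4 f51 f52 f6 :: "'a \<Rightarrow> real"
    and n m k :: nat and p :: 'b
    and c :: "('b, 'v) chart" and C :: "('a, 'e) chart"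
    and F :: "'v \<Rightarrow> 'e" and G :: "'v \<Rightarrow> 'v \<Rightarrow> 'v \<Rightarrow> real" and y :: 'v and x :: 'e
    and e :: "nat \<Rightarrow> 'v" and h\<^sub>T \<phi>h\<^sub>T :: "'v \<Rightarrow> 'v" and H :: 'e
  assumes "DIM('v) = n" and "3 \<le> n" and "DIM('e) = 2 * m + 1"
    and "gen_km_contact_space_form_divided X A \<phi> \<xi> \<eta> g f1 f2 f3 f4 f51 f52 f6"
    and "immersed_submanifold Y B X A \<iota>"
    and "C_totally_real B A \<xi> g \<iota>"
    and "2 \<le> k" and "k \<le> n" and "p \<in> topspace Y"
    and "c \<in> B" and "p \<in> chart_dom c" and "C \<in> A" and "\<iota> p \<in> chart_dom C"
    and "F = local_map c C \<iota>" and "y = coords c p" and "x = coords C (\<iota> p)"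
    and "G = induced_metric (g C) F"
    and "orthonormal_basis_of (G y) UNIV n e"
    and "H = mean_curvature_vector (g C) F y e"
    and "h\<^sub>T = tangential_part (g C) F y (h_op (\<xi> C) (\<phi> C) x)"
    and "\<phi>h\<^sub>T = tangential_part (g C) F y (\<phi> C x \<circ> h_op (\<xi> C) (\<phi> C) x)"
  shows "real n * (real n - 1) * g C x H H \<ge>
           real n * (real n - 1) * theta_k G y k
           - real n * (real n - 1) * f1 (\<iota> p)
           - 2 * (real n - 1) * f4 (\<iota> p) * trace_wrt (G y) e h\<^sub>T
           - f51 (\<iota> p) * ((trace_wrt (G y) e h\<^sub>T)\<^sup>2 - sqnorm_wrt (G y) e h\<^sub>T)
           + f52 (\<iota> p) * (sqnorm_wrt (G y) e \<phi>h\<^sub>T - (trace_wrt (G y) e \<phi>h\<^sub>T)\<^sup>2)"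
proof -
  note sf = assms(4)[unfolded gen_km_contact_space_form_divided_def]
  have contact: "contact_metric X A \<phi> \<xi> \<eta> g" using sf by blast
  then have X: "smooth_manifold X A" and metric: "riemannian_metric A g"
    by (auto simp: contact_metric_def almost_contact_metric_def)
  have Y: "smooth_manifold Y B" using assms(5) by (simp add: immersed_submanifold_def)
  have y: "y \<in> local_dom c C \<iota>" using assms by (auto simp: local_dom_def)
  have x: "F y = x"
    using assms chart_inv_coords[OF Y \<open>c \<in> B\<close> \<open>p \<in> chart_dom c\<close>] by (simp add: local_map_def)
  interpret im: coordinate_immersion "g C" "chart_image C" F "local_dom c C \<iota>"
    unfolding \<open>F = local_map c C \<iota>\<close>
    by (rule coordinate_immersion_chart[OF X metric assms(5) \<open>c \<in> B\<close> \<open>C \<in> A\<close>])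
  interpret con: contact_chart "g C" "\<phi> C" "\<xi> C" "\<eta> C" "chart_image C"
    by (rule contact_chart_of_contact_metric[OF contact \<open>C \<in> A\<close>])
  \<comment> \<open>The coefficient functions enter through their values at
    \<open>\<iota> p\<close>, the point with coordinates \<open>F y\<close>.\<close>
  interpret C_totally_real_chart "g C" "chart_image C" F "local_dom c C \<iota>" "\<phi> C" "\<xi> C" "\<eta> C" y
    "f1 (\<iota> p)" "f2 (\<iota> p)" "f3 (\<iota> p)" "f4 (\<iota> p)" "f51 (\<iota> p)" "f52 (\<iota> p)" "f6 (\<iota> p)"
  proof unfold_locales
    show "y \<in> local_dom c C \<iota>" by (rule y)
    show "g C (F z) (\<xi> C (F z)) (dirderiv F z u) = 0" if "z \<in> local_dom c C \<iota>" for z u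
      using assms(6) that \<open>c \<in> B\<close> \<open>C \<in> A\<close> unfolding C_totally_real_def \<open>F = local_map c C \<iota>\<close> Let_def
      by blast
    have "\<forall>q\<in>chart_dom C. let x = coords C q; G = g C x; \<Phi> = \<phi> C x; \<Xi> = \<xi> C x; H = \<eta> C x;
            h = h_op (\<xi> C) (\<phi> C) x
        in \<forall>u v w. curvature (g C) x u v w =
             f1 q *\<^sub>R R1 G u v w + f2 q *\<^sub>R R2 G \<Phi> u v w + f3 q *\<^sub>R R3 G \<Xi> H u v w
             + f4 q *\<^sub>R R4 G h u v w + f51 q *\<^sub>R R51 G h u v w + f52 q *\<^sub>R R52 G \<Phi> h u v w
             + f6 q *\<^sub>R R6 G \<Xi> H h u v w"
      using sf \<open>C \<in> A\<close> unfolding gen_km_space_form_divided_def by blast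
    from this[THEN bspec, OF \<open>\<iota> p \<in> chart_dom C\<close>, folded \<open>x = coords C (\<iota> p)\<close>, unfolded Let_def x[symmetric]]
    show "curvature (g C) (F y) u v w =
      f1 (\<iota> p) *\<^sub>R R1 (g C (F y)) u v w + f2 (\<iota> p) *\<^sub>R R2 (g C (F y)) (\<phi> C (F y)) u v w
      + f3 (\<iota> p) *\<^sub>R R3 (g C (F y)) (\<xi> C (F y)) (\<eta> C (F y)) u v w
      + f4 (\<iota> p) *\<^sub>R R4 (g C (F y)) (h_op (\<xi> C) (\<phi> C) (F y)) u v w
      + f51 (\<iota> p) *\<^sub>R R51 (g C (F y)) (h_op (\<xi> C) (\<phi> C) (F y)) u v w
      + f52 (\<iota> p) *\<^sub>R R52 (g C (F y)) (\<phi> C (F y)) (h_op (\<xi> C) (\<phi> C) (F y)) u v w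
      + f6 (\<iota> p) *\<^sub>R R6 (g C (F y)) (\<xi> C (F y)) (\<eta> C (F y)) (h_op (\<xi> C) (\<phi> C) (F y)) u v w"
      for u v w by blast
  qed
  show ?thesis
    using chen_ricci_inequality[OF assms(1,7,8)] assms(17-21) by (simp add: x)
qed

end
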